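(* A metrizable locally convex space $X$ is normable if and only if its hyperspace $2^X$ is an ANR.
   Context: A linear topological space $X$ is normable if its topology is determined by a norm. The space $X$ carries its natural (translation-invariant) linear uniformity, with base of entourages $\{(x,y):x-y\in W\}$, $W$ a neighborhood of the origin. $2^X$ is the set of all non-empty closed subsets of $X$ with the uniform topology, i.e. the topology generated by the metric $\min\{1,d_H\}$ where $d$ is any metric generating the uniformity of $X$ and $d_H(A,B)=\max\{\sup_{x\in B}d(x,A),\sup_{x\in A}d(x,B)\}\in[0,\infty]$; this topology depends only on the uniformity. A metric space $Y$ is an ANR if for each metric space $M$ containing $Y$ isometrically as a closed subset there is a (continuous) retraction $r:U\to Y$ from some open neighborhood $U$ of $Y$ in $M$. *)

theory Defs
  imports "HOL-Analysis.Analysis"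
begin

class topological_real_vector = real_vector + topological_ab_group_add +
  assumes tendsto_scaleR_Pair:
    "LIM p (nhds c \<times>\<^sub>F nhds x). fst p *\<^sub>R snd p :> nhds (c *\<^sub>R x)"

instance real_normed_vector \<subseteq> topological_real_vector
proof
  fix c :: real and x :: 'a
  show "LIM p (nhds c \<times>\<^sub>F nhds x). fst p *\<^sub>R snd p :> nhds (c *\<^sub>R x)"
    using tendsto_scaleR[OF tendsto_fst tendsto_snd, OF filterlim_ident filterlim_ident, of "(c, x)"]
    by (simp add: nhds_prod)
qed

definition locally_convex :: "'a::topological_real_vector itself \<Rightarrow> bool" where
  "locally_convex T \<longleftrightarrow>
    (\<forall>U :: 'a set. open U \<and> 0 \<in> U \<longrightarrow> (\<exists>V. open V \<and> 0 \<in> V \<and> convex V \<and> V \<subseteq> U))"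

definition normable :: "'a::topological_real_vector itself \<Rightarrow> bool" where
  "normable T \<longleftrightarrow>
    (\<exists>n :: 'a \<Rightarrow> real.
      (\<forall>x. n x \<ge> 0) \<and> (\<forall>x. n x = 0 \<longleftrightarrow> x = 0) \<and>
      (\<forall>c x. n (c *\<^sub>R x) = \<bar>c\<bar> * n x) \<and> (\<forall>x y. n (x + y) \<le> n x + n y) \<and>
      (euclidean :: 'a topology) = Metric_space.mtopology UNIV (\<lambda>x y. n (x - y)))"

definition linear_uniformity :: "('a::topological_real_vector \<times> 'a) filter" where
  "linear_uniformity = (INF W\<in>{W. open W \<and> 0 \<in> W}. principal {(x, y). x - y \<in> W})"

definition generates_linear_uniformity :: "'a::topological_real_vector metric \<Rightarrow> bool" where
  "generates_linear_uniformity d \<longleftrightarrow>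
    mspace d = UNIV \<and>
    (INF e\<in>{0<..}. principal {(x, y). mdist d x y < e}) = linear_uniformity"

definition hausdorff_dist :: "'a metric \<Rightarrow> 'a set \<Rightarrow> 'a set \<Rightarrow> ennreal" where
  "hausdorff_dist d A B =
    max (SUP x\<in>B. INF a\<in>A. ennreal (mdist d x a)) (SUP x\<in>A. INF b\<in>B. ennreal (mdist d x b))"

definition hyperspace :: "'a::topological_space metric \<Rightarrow> 'a set metric" where
  "hyperspace d =
    metric ({A. closed A \<and> A \<noteq> {}}, \<lambda>A B. enn2real (min 1 (hausdorff_dist d A B)))"

text \<open>Isabelle/HOL cannot quantify over types inside a formula, so the ambient metric spaces
  range over all metric spaces carried by subsets of a given type. Containing \<open>Y\<close>
  isometrically as a closed subset is expressed by an isometric embedding \<open>e\<close>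
  with closed image. If the type is too small to hold a closed copy of \<open>Y\<close>, the
  condition is vacuous; a type of the form \<open>'m + ('y \<Rightarrow> real)\<close> avoids this, since
  the right summand holds the convex hull of the Kuratowski image of \<open>Y\<close> in the bounded
  functions, in which that image is closed, while an arbitrary \<open>'m\<close> on the left accounts
  for all remaining ambient spaces.\<close>

definition metric_ANR :: "'m itself \<Rightarrow> 'y metric \<Rightarrow> bool" where
  "metric_ANR T Y \<longleftrightarrow>
    (\<forall>(M :: 'm metric) e.
      (\<forall>x\<in>mspace Y. \<forall>y\<in>mspace Y. mdist M (e x) (e y) = mdist Y x y) \<and>
      closedin (mtopology_of M) (e ` mspace Y) \<longrightarrow>
      (\<exists>U. openin (mtopology_of M) U \<and> e ` mspace Y \<subseteq> U \<and>
        e ` mspace Y retract_of_space subtopology (mtopology_of M) U))"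

text \<open>The pair defining \<^const>\<open>hyperspace\<close> is a metric space, so the abstraction
  function \<^const>\<open>metric\<close> is applied within its domain.\<close>

lemma hausdorff_dist_commute: "hausdorff_dist d A B = hausdorff_dist d B A"
  by (simp add: hausdorff_dist_def max.commute)

lemma hausdorff_dist_self:
  assumes "mspace d = UNIV"
  shows "hausdorff_dist d A A = 0"
proof -
  have "(INF a\<in>A. ennreal (mdist d x a)) = 0" if "x \<in> A" for x
  proof -
    have "(INF a\<in>A. ennreal (mdist d x a)) \<le> ennreal (mdist d x x)"
      using that by (rule INF_lower)
    also have "mdist d x x = 0"
      using assms by simp
    finally show ?thesis by (simp only: ennreal_0 le_zero_eq)
  qed
  then show ?thesis
    by (cases "A = {}") (simp_all add: hausdorff_dist_def bot_ennreal)
qed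

lemma INF_add_const_ennreal:
  fixes f :: "'b \<Rightarrow> ennreal"
  assumes "I \<noteq> {}"
  shows "(INF i\<in>I. f i + c) = (INF i\<in>I. f i) + c"
  using continuous_at_Inf_mono[of "\<lambda>x. x + c" "f ` I"]
  using continuous_add[of "at_right (Inf (f ` I))", of "\<lambda>x. x" "\<lambda>x. c"]
  using assms by (auto simp: mono_def image_comp intro: add_mono)

lemma excess_triangle:
  assumes "mspace d = UNIV" "B \<noteq> {}"
  shows "(SUP x\<in>A. INF c\<in>C. ennreal (mdist d x c)) \<le>
    (SUP x\<in>A. INF b\<in>B. ennreal (mdist d x b)) + (SUP x\<in>B. INF c\<in>C. ennreal (mdist d x c))"
    (is "_ \<le> ?P + ?Q")
proof (rule SUP_least)
  fix x assume x: "x \<in> A"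
  have "(INF c\<in>C. ennreal (mdist d x c)) \<le> ennreal (mdist d x b) + ?Q" if b: "b \<in> B" for b
  proof -
    have "(INF c\<in>C. ennreal (mdist d x c)) \<le> (INF c\<in>C. ennreal (mdist d x b) + ennreal (mdist d b c))"
    proof (rule INF_mono)
      fix c assume "c \<in> C"
      then show "\<exists>n\<in>C. ennreal (mdist d x n) \<le> ennreal (mdist d x b) + ennreal (mdist d b c)"
        using mdist_triangle[of x d b c] assms(1)
        by (intro bexI[of _ c]) (auto simp flip: ennreal_plus intro: ennreal_leI)
    qed
    also have "\<dots> = ennreal (mdist d x b) + (INF c\<in>C. ennreal (mdist d b c))"
      by (cases "C = {}") (simp_all add: INF_add_const_ennreal add.commute)
    also have "\<dots> \<le> ennreal (mdist d x b) + ?Q"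
      using b by (intro add_left_mono SUP_upper)
    finally show ?thesis .
  qed
  then have "(INF c\<in>C. ennreal (mdist d x c)) \<le> (INF b\<in>B. ennreal (mdist d x b) + ?Q)"
    by (rule INF_greatest)
  also have "\<dots> = (INF b\<in>B. ennreal (mdist d x b)) + ?Q"
    using assms(2) by (simp add: INF_add_const_ennreal)
  also have "\<dots> \<le> ?P + ?Q"
    using x by (intro add_right_mono SUP_upper)
  finally show "(INF c\<in>C. ennreal (mdist d x c)) \<le> ?P + ?Q" .
qed

lemma hausdorff_dist_triangle:
  assumes "mspace d = UNIV" "B \<noteq> {}"
  shows "hausdorff_dist d A C \<le> hausdorff_dist d A B + hausdorff_dist d B C"
proof -
  note * = excess_triangle[OF assms]
  have "(SUP x\<in>A. INF c\<in>C. ennreal (mdist d x c)) \<le> hausdorff_dist d A B + hausdorff_dist d B C"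
    by (rule order_trans[OF *]) (auto simp: hausdorff_dist_def intro: add_mono)
  moreover have "(SUP x\<in>C. INF c\<in>A. ennreal (mdist d x c))
      \<le> hausdorff_dist d A B + hausdorff_dist d B C"
    by (rule order_trans[OF *], subst add.commute) (auto simp: hausdorff_dist_def intro: add_mono)
  ultimately show ?thesis
    by (subst hausdorff_dist_def) simp
qed

lemma generates_linear_uniformity_separates:
  fixes d :: "'a::topological_real_vector metric"
  assumes d: "generates_linear_uniformity d" and "closed A"
    and 0: "(INF a\<in>A. ennreal (mdist d x a)) = 0"
  shows "x \<in> A"
proof (rule ccontr)
  assume x: "x \<notin> A"
  define W where "W = (\<lambda>w. x - w) -` (- A)"
  have "continuous_on UNIV (\<lambda>w. x - w)"
    unfolding diff_conv_add_uminus by (intro continuous_intros)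
  then have "open W" "0 \<in> W"
    using x \<open>closed A\<close> by (auto simp: W_def intro!: open_vimage)
  then have "eventually (\<lambda>(x, y). x - y \<in> W) linear_uniformity"
    unfolding linear_uniformity_def
    by (intro eventually_INF1[of W]) (auto simp: eventually_principal)
  then have "eventually (\<lambda>(x, y). x - y \<in> W) (INF e\<in>{0<..}. principal {(x, y). mdist d x y < e})"
    using d by (simp add: generates_linear_uniformity_def)
  then obtain e where e: "e > 0" "\<And>x y. mdist d x y < e \<Longrightarrow> x - y \<in> W"
    by (subst (asm) eventually_INF_base)
      (auto simp: eventually_principal subset_eq intro: bexI[of _ "min _ _"])
  have "ennreal e \<le> (INF a\<in>A. ennreal (mdist d x a))"
  proof (rule INF_greatest)
    fix a assume "a \<in> A"
    then have "x - a \<notin> W" by (simp add: W_def)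
    then show "ennreal e \<le> ennreal (mdist d x a)"
      using e(2)[of x a] by (intro ennreal_leI) force
  qed
  then show False using 0 e(1) by simp
qed

lemma Metric_space_hyperspace:
  fixes d :: "'a::topological_real_vector metric"
  assumes d: "generates_linear_uniformity d"
  shows "Metric_space {A. closed A \<and> A \<noteq> {}} (\<lambda>A B. enn2real (min 1 (hausdorff_dist d A B)))"
proof
  note U = d[unfolded generates_linear_uniformity_def, THEN conjunct1]
  have fin: "min 1 h < top" for h :: ennreal
    by (simp add: min_less_iff_disj)
  show "0 \<le> enn2real (min 1 (hausdorff_dist d A B))" for A B
    by simp
  show "enn2real (min 1 (hausdorff_dist d A B)) = enn2real (min 1 (hausdorff_dist d B A))" for A B
    by (simp add: hausdorff_dist_commute)
  show "enn2real (min 1 (hausdorff_dist d A B)) = 0 \<longleftrightarrow> A = B"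
    if "A \<in> {A. closed A \<and> A \<noteq> {}}" "B \<in> {A. closed A \<and> A \<noteq> {}}" for A B
  proof
    assume "enn2real (min 1 (hausdorff_dist d A B)) = 0"
    then have "hausdorff_dist d A B = 0"
      using fin[of "hausdorff_dist d A B"] by (auto simp: enn2real_eq_0_iff min_def split: if_splits)
    then have *: "(SUP x\<in>B. INF a\<in>A. ennreal (mdist d x a)) \<le> 0"
      "(SUP x\<in>A. INF b\<in>B. ennreal (mdist d x b)) \<le> 0"
      unfolding hausdorff_dist_def by (metis max.cobounded1, metis max.cobounded2)
    have "x \<in> A" if "x \<in> B" for x
    proof (rule generates_linear_uniformity_separates[OF d])
      show "closed A" using \<open>A \<in> _\<close> by blast
      have "(INF a\<in>A. ennreal (mdist d x a)) \<le> 0"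
        using SUP_upper[OF that] *(1) by (rule order_trans)
      then show "(INF a\<in>A. ennreal (mdist d x a)) = 0" by (rule antisym) (rule zero_le)
    qed
    moreover have "x \<in> B" if "x \<in> A" for x
    proof (rule generates_linear_uniformity_separates[OF d])
      show "closed B" using \<open>B \<in> _\<close> by blast
      have "(INF b\<in>B. ennreal (mdist d x b)) \<le> 0"
        using SUP_upper[OF that] *(2) by (rule order_trans)
      then show "(INF b\<in>B. ennreal (mdist d x b)) = 0" by (rule antisym) (rule zero_le)
    qed
    ultimately show "A = B" by blast
  next
    assume "A = B"
    then show "enn2real (min 1 (hausdorff_dist d A B)) = 0"
      by (simp add: hausdorff_dist_self[OF U])
  qed
  show "enn2real (min 1 (hausdorff_dist d A C))
      \<le> enn2real (min 1 (hausdorff_dist d A B)) + enn2real (min 1 (hausdorff_dist d B C))"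
    if "B \<in> {A. closed A \<and> A \<noteq> {}}" for A B C
  proof -
    have "min 1 (hausdorff_dist d A C) \<le> min 1 (hausdorff_dist d A B + hausdorff_dist d B C)"
      using hausdorff_dist_triangle[OF U, of B A C] that by (intro min.mono) auto
    also have "\<dots> \<le> min 1 (hausdorff_dist d A B) + min 1 (hausdorff_dist d B C)"
      by (auto simp: min_def add_increasing add_increasing2)
    finally have "enn2real (min 1 (hausdorff_dist d A C))
        \<le> enn2real (min 1 (hausdorff_dist d A B) + min 1 (hausdorff_dist d B C))"
      using fin by (intro enn2real_mono) auto
    also have "\<dots> = enn2real (min 1 (hausdorff_dist d A B)) + enn2real (min 1 (hausdorff_dist d B C))"
      using fin by (intro enn2real_plus)
    finally show ?thesis .
  qed
qed

lemma
  fixes d :: "'a::topological_real_vector metric"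
  assumes "generates_linear_uniformity d"
  shows mspace_hyperspace: "mspace (hyperspace d) = {A. closed A \<and> A \<noteq> {}}"
    and mdist_hyperspace:
      "mdist (hyperspace d) = (\<lambda>A B. enn2real (min 1 (hausdorff_dist d A B)))"
  using Metric_space_hyperspace[OF assms]
  by (simp_all add: hyperspace_def Metric_space.mspace_metric Metric_space.mdist_metric)

end

theory Submission
  imports Defs
begin

text \<open>
  If \<open>2\<^sup>X\<close> is an ANR, it is connected near the point \<open>{0}\<close>: inside a cone over the hyperspace
  the segments from \<open>{0}\<close> to nearby points stay in the neighborhood that is retracted, so their
  images are paths in \<open>2\<^sup>X\<close> (lemma \<open>ANR_locally_connected\<close>). On the other hand, for a convex
  neighborhood \<open>W\<close> of the origin, two closed sets at small Hausdorff distance are either both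
  absorbed by \<open>W\<close> or both not absorbed, so the sets absorbed by \<open>W\<close> form a clopen part of the
  hyperspace. Hence everything connected to \<open>{0}\<close> is bounded. Every sufficiently small closed
  neighborhood of the origin is close to \<open>{0}\<close> in \<open>2\<^sup>X\<close>, hence connected to it, hence bounded, and a
  locally convex Hausdorff space with a bounded neighborhood of the origin is normed by a Minkowski
  functional (theorem \<open>Kolmogorov_normability\<close>).

  Conversely let \<open>n\<close> be a norm for \<open>X\<close> and let \<open>2\<^sup>X\<close> be a closed subset \<open>F\<close> of \<open>M\<close>, with \<open>g a\<close> the
  closed set that the point \<open>a\<close> stands for. The embedding being isometric, \<open>g\<close> is uniformly
  continuous, and after replacing the metric of \<open>M\<close> by a uniformly equivalent distance \<open>D\<close> (via a
  concave modulus of continuity) it is even non-expanding at small scale for the Hausdorff distance of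
  \<open>n\<close>. Then there is an explicit uniformly continuous extension of \<open>g\<close> to a neighborhood of \<open>F\<close>:
  with \<open>\<delta>(x)\<close> the distance of \<open>x\<close> from \<open>F\<close> and \<open>n(y, g a)\<close> that of \<open>y\<close> from \<open>g a\<close>, send \<open>x\<close> to the set
  of all \<open>y\<close> for which the infimum of \<open>n(y, g a) + 3 D(x,a)\<close> over \<open>a \<in> F\<close> is at most \<open>12 \<delta>(x)\<close>.
  It is essentially a union of balls around the sets \<open>g a\<close>, of radius \<open>12 \<delta>(x) - 3 D(x,a)\<close>. When \<open>x\<close> moves,
  the radii change slowly, and a norm makes balls depend continuously on the radius. When the radius
  for some \<open>a\<close> shrinks to zero, the set \<open>g a\<close> drops out, but by then it is covered by the ball around
  \<open>g b\<close> for a point \<open>b\<close> of \<open>F\<close> nearly closest to \<open>x\<close>. This is the content of lemma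
  \<open>extension_close\<close>.
\<close>

section \<open>Metric topologies\<close>

lemma continuous_map_mtopology_of_iff:
  "continuous_map (mtopology_of m1) (mtopology_of m2) f \<longleftrightarrow>
    f ` mspace m1 \<subseteq> mspace m2 \<and>
    (\<forall>a\<in>mspace m1. \<forall>\<epsilon>>0. \<exists>\<delta>>0. \<forall>x. x \<in> mspace m1 \<and> mdist m1 a x < \<delta> \<longrightarrow> mdist m2 (f a) (f x) < \<epsilon>)"
  unfolding mtopology_of_def
  by (rule Metric_space.metric_continuous_map) (rule Metric_space_mspace_mdist)+

lemma openin_mtopology_of_iff:
  "openin (mtopology_of m) U \<longleftrightarrow> U \<subseteq> mspace m \<and> (\<forall>x\<in>U. \<exists>r>0. mball_of m x r \<subseteq> U)"
  unfolding mtopology_of_def mball_of_def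
  by (simp add: Metric_space.openin_mtopology[OF Metric_space_mspace_mdist] Ball_def)

lemma closedin_mtopology_of_iff:
  "closedin (mtopology_of m) C \<longleftrightarrow>
    C \<subseteq> mspace m \<and> (\<forall>x\<in>mspace m - C. \<exists>r>0. \<forall>y\<in>C. r \<le> mdist m x y)"
proof -
  have "disjnt C (mball_of m x r) \<longleftrightarrow> (\<forall>y\<in>C. r \<le> mdist m x y)"
    if "C \<subseteq> mspace m" "x \<in> mspace m" for x r
    using that by (auto simp: disjnt_iff not_less subset_iff)
  then show ?thesis
    unfolding mtopology_of_def Metric_space.closedin_metric[OF Metric_space_mspace_mdist]
    by (metis DiffD1 mball_of_def)
qed

lemma mdist_self: "x \<in> mspace m \<Longrightarrow> mdist m x x = 0"
  by simp

section \<open>Local connectedness of metric ANRs\<close>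

text \<open>
  The truncation at 1 makes this a metric on all functions, bounded or not. Between the distance
  functions of a metric with values in \<open>[0,1]\<close> it is the usual supremum distance.
\<close>

definition supdist :: "('y \<Rightarrow> real) \<Rightarrow> ('y \<Rightarrow> real) \<Rightarrow> real" where
  "supdist f g = (SUP z. min 1 \<bar>f z - g z\<bar>)"

lemma supdist_upper: "min 1 \<bar>f z - g z\<bar> \<le> supdist f g"
  unfolding supdist_def by (rule cSUP_upper[OF UNIV_I]) (auto intro!: bdd_aboveI2[where M = 1])

lemma supdist_least: "(\<And>z. min 1 \<bar>f z - g z\<bar> \<le> c) \<Longrightarrow> supdist f g \<le> c"
  unfolding supdist_def by (rule cSUP_least) auto

lemma Metric_space_supdist: "Metric_space UNIV supdist"
proof
  fix f g h :: "'a \<Rightarrow> real"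
  show "supdist f g = supdist g f"
    by (simp add: supdist_def abs_minus_commute)
  show nonneg: "0 \<le> supdist f g"
    using supdist_upper[of f undefined g] by linarith
  show "supdist f g = 0 \<longleftrightarrow> f = g"
  proof
    assume "supdist f g = 0"
    show "f = g"
    proof
      fix z show "f z = g z"
        using supdist_upper[of f z g] \<open>supdist f g = 0\<close> by (auto simp: min_def split: if_splits)
    qed
  next
    assume "f = g"
    then have "supdist f g \<le> 0"
      by (intro supdist_least) auto
    then show "supdist f g = 0"
      using nonneg by linarith
  qed
  show "supdist f h \<le> supdist f g + supdist g h"
  proof (rule supdist_least)
    fix z
    show "min 1 \<bar>f z - h z\<bar> \<le> supdist f g + supdist g h"
      using supdist_upper[of f z g] supdist_upper[of g z h] by linarith
  qed
qed

text \<open>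
  Kuratowski's embedding of a metric space by distance functions, extended by 0 off the carrier
  to have one definite function for each point.
\<close>

definition kuratowski :: "'y metric \<Rightarrow> 'y \<Rightarrow> 'y \<Rightarrow> real" where
  "kuratowski Y y = (\<lambda>z. if z \<in> mspace Y then mdist Y y z else 0)"

lemma supdist_kuratowski:
  assumes "\<And>x y. x \<in> mspace Y \<Longrightarrow> y \<in> mspace Y \<Longrightarrow> mdist Y x y \<le> 1"
    and x: "x \<in> mspace Y" and y: "y \<in> mspace Y"
  shows "supdist (kuratowski Y x) (kuratowski Y y) = mdist Y x y"
proof (rule antisym)
  show "supdist (kuratowski Y x) (kuratowski Y y) \<le> mdist Y x y"
  proof (rule supdist_least)
    fix z
    show "min 1 \<bar>kuratowski Y x z - kuratowski Y y z\<bar> \<le> mdist Y x y"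
      using mdist_triangle[of x Y y z] mdist_triangle[of y Y x z] x y
      by (auto simp: kuratowski_def mdist_commute)
  qed
  show "mdist Y x y \<le> supdist (kuratowski Y x) (kuratowski Y y)"
    using supdist_upper[of "kuratowski Y x" y "kuratowski Y y"] assms(1)[OF x y]
x y by (simp add: kuratowski_def mdist_self)
qed

definition segment_map :: "'y metric \<Rightarrow> 'y \<Rightarrow> 'y \<Rightarrow> real \<Rightarrow> 'y \<Rightarrow> real" where
  "segment_map Y a y t = (\<lambda>z. (1 - t) * kuratowski Y a z + t * kuratowski Y y z)"

text \<open>
  The union of all straight segments that join the Kuratowski image of \<open>a\<close> to that of another point.
  For local connectedness at \<open>a\<close> alone these segments suffice in place of the whole convex hull. The
  injection \<open>Inr\<close> places the cone in a type that also has room for other ambient spaces.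
\<close>

definition cone_metric :: "'y metric \<Rightarrow> 'y \<Rightarrow> ('m + ('y \<Rightarrow> real)) metric" where
  "cone_metric Y a = metric (Inr ` {segment_map Y a y t |y t. y \<in> mspace Y \<and> 0 \<le> t \<and> t \<le> 1},
     \<lambda>u v. supdist (projr u) (projr v))"

lemma
  fixes Y :: "'y metric"
  shows mspace_cone_metric: "mspace (cone_metric Y a :: ('m + ('y \<Rightarrow> real)) metric) =
      Inr ` {segment_map Y a y t |y t. y \<in> mspace Y \<and> 0 \<le> t \<and> t \<le> 1}" (is "_ = ?S")
    and mdist_cone_metric: "mdist (cone_metric Y a :: ('m + ('y \<Rightarrow> real)) metric) = (\<lambda>u v. supdist (projr u) (projr v))"
proof -
  interpret K: Metric_space UNIV "supdist :: ('y \<Rightarrow> real) \<Rightarrow> _"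
    by (rule Metric_space_supdist)
  have *: "Metric_space ?S (\<lambda>u v. supdist (projr u) (projr v))"
    by standard (auto simp: K.commute intro: K.triangle)
  show "mspace (cone_metric Y a :: ('m + ('y \<Rightarrow> real)) metric) = ?S"
    unfolding cone_metric_def by (rule Metric_space.mspace_metric[OF *])
  show "mdist (cone_metric Y a :: ('m + ('y \<Rightarrow> real)) metric) = (\<lambda>u v. supdist (projr u) (projr v))"
    unfolding cone_metric_def by (rule Metric_space.mdist_metric[OF *])
qed

lemma supdist_segment_map:
  assumes "a \<in> mspace Y" "y \<in> mspace Y"
  shows "supdist (segment_map Y a y s) (segment_map Y a y t) \<le> \<bar>s - t\<bar> * mdist Y a y"
proof (rule supdist_least)
  fix z
  have "\<bar>kuratowski Y y z - kuratowski Y a z\<bar> \<le> mdist Y a y"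
    using mdist_triangle[of a Y y z] mdist_triangle[of y Y a z] assms
    by (auto simp: kuratowski_def mdist_commute)
  moreover have "segment_map Y a y s z - segment_map Y a y t z
      = (s - t) * (kuratowski Y y z - kuratowski Y a z)"
    by (simp add: segment_map_def algebra_simps)
  ultimately show "min 1 \<bar>segment_map Y a y s z - segment_map Y a y t z\<bar> \<le> \<bar>s - t\<bar> * mdist Y a y"
    by (metis abs_mult abs_ge_zero min.coboundedI2 mult_left_mono)
qed

text \<open>
  The function \<open>kuratowski Y z\<close> vanishes at \<open>z\<close>, so a point \<open>(1 - t) * kuratowski Y a + t * kuratowski Y y\<close>
  of the cone close to it must take a small value there. This value is a convex combination of the
  distances of \<open>z\<close> from \<open>a\<close> and from \<open>y\<close>, which cannot both be small. So an interior point of a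
  nontrivial segment keeps a positive distance from the whole embedded space.
\<close>

lemma closedin_kuratowski_cone:
  assumes bounded: "\<And>x y. x \<in> mspace Y \<Longrightarrow> y \<in> mspace Y \<Longrightarrow> mdist Y x y \<le> 1"
    and a: "a \<in> mspace Y"
  shows "closedin (mtopology_of (cone_metric Y a)) ((Inr \<circ> kuratowski Y) ` mspace Y)"
    (is "closedin _ ?F")
  unfolding closedin_mtopology_of_iff
proof (intro conjI ballI subsetI)
  fix u assume "u \<in> ?F"
  then obtain y where "y \<in> mspace Y" "u = Inr (kuratowski Y y)" by auto
  moreover have "kuratowski Y y = segment_map Y a y 1"
    by (simp add: segment_map_def)
  ultimately show "u \<in> mspace (cone_metric Y a)"
    by (force simp: mspace_cone_metric)
next
  fix u assume u: "u \<in> mspace (cone_metric Y a) - ?F"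
  then obtain y t where y: "y \<in> mspace Y" "0 \<le> t" "t \<le> 1" and eq: "u = Inr (segment_map Y a y t)"
    by (auto simp: mspace_cone_metric)
  have "kuratowski Y a \<noteq> segment_map Y a y t" "kuratowski Y y \<noteq> segment_map Y a y t"
    using u eq a y by (metis DiffD2 comp_apply image_eqI)+
  then have "t \<noteq> 0" "t \<noteq> 1" "a \<noteq> y"
    by (auto simp: segment_map_def algebra_simps)
  then have r: "0 < min t (1 - t) * mdist Y a y" (is "0 < ?r")
    using y a by (auto intro!: mult_pos_pos simp: order_less_le)
  have "?r \<le> 1"
    using mult_le_one[of "min t (1 - t)" "mdist Y a y"] y bounded[OF a y(1)] by auto
  have "?r \<le> mdist (cone_metric Y a) u v" if "v \<in> ?F" for v
  proof -
    obtain z where z: "z \<in> mspace Y" "v = Inr (kuratowski Y z)"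
      using \<open>v \<in> ?F\<close> by auto
    have "?r \<le> min t (1 - t) * (mdist Y a z + mdist Y y z)"
      using mdist_triangle[of a Y z y] a y z by (intro mult_left_mono) (auto simp: mdist_commute)
    also have "\<dots> \<le> (1 - t) * mdist Y a z + t * mdist Y y z"
      by (simp add: distrib_left add_mono mult_right_mono)
    also have "\<dots> = \<bar>segment_map Y a y t z - kuratowski Y z z\<bar>"
      using z y by (simp add: segment_map_def kuratowski_def mdist_self)
    finally have "?r \<le> min 1 \<bar>segment_map Y a y t z - kuratowski Y z z\<bar>"
      using \<open>?r \<le> 1\<close> by simp
    also have "\<dots> \<le> supdist (segment_map Y a y t) (kuratowski Y z)"
      by (rule supdist_upper)
    finally show ?thesis
      using z by (simp add: mdist_cone_metric eq)
  qed
  then show "\<exists>r>0. \<forall>v\<in>?F. r \<le> mdist (cone_metric Y a) u v"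
    using r by (intro exI[of _ ?r] conjI ballI)
qed

text \<open>
  The segment from \<open>a\<close> to a nearby point \<open>y\<close> stays in the closed ball around \<open>a\<close> of radius \<open>mdist Y a y\<close>,
  hence in the neighborhood on which the retraction is defined. The retraction turns it into a path
  in the embedded copy of \<open>Y\<close>, which the inverse isometry carries back to \<open>Y\<close>.
\<close>

lemma ANR_locally_connected:
  fixes Y :: "'y metric"
  assumes ANR: "metric_ANR TYPE('m + ('y \<Rightarrow> real)) Y"
    and bounded: "\<And>x y. x \<in> mspace Y \<Longrightarrow> y \<in> mspace Y \<Longrightarrow> mdist Y x y \<le> 1"
    and a: "a \<in> mspace Y"
  obtains \<epsilon> where "\<epsilon> > 0"
    "\<forall>y\<in>mspace Y. mdist Y a y < \<epsilon> \<longrightarrow> (\<exists>S. connectedin (mtopology_of Y) S \<and> a \<in> S \<and> y \<in> S)"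
proof -
  let ?M = "cone_metric Y a :: ('m + ('y \<Rightarrow> real)) metric"
  let ?e = "Inr \<circ> kuratowski Y :: 'y \<Rightarrow> 'm + ('y \<Rightarrow> real)"
  let ?F = "?e ` mspace Y"
  have isometry: "mdist ?M (?e x) (?e y) = mdist Y x y" if "x \<in> mspace Y" "y \<in> mspace Y" for x y
    using that by (simp add: mdist_cone_metric supdist_kuratowski[OF bounded])
  have closed: "closedin (mtopology_of ?M) ?F"
    by (rule closedin_kuratowski_cone[OF bounded a])
  have "(\<forall>x\<in>mspace Y. \<forall>y\<in>mspace Y. mdist ?M (?e x) (?e y) = mdist Y x y) \<and>
      closedin (mtopology_of ?M) ?F"
    using isometry closed by blast
  then have "\<exists>U. openin (mtopology_of ?M) U \<and> ?F \<subseteq> U \<and> ?F retract_of_space subtopology (mtopology_of ?M) U"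
    by (rule ANR[unfolded metric_ANR_def, rule_format])
  then obtain U where U: "openin (mtopology_of ?M) U" "?F \<subseteq> U"
    and retract: "?F retract_of_space subtopology (mtopology_of ?M) U"
    by (elim exE conjE)
  obtain r where r: "continuous_map (subtopology (mtopology_of ?M) U)
        (subtopology (subtopology (mtopology_of ?M) U) ?F) r" "\<And>x. x \<in> ?F \<Longrightarrow> r x = x"
    using retract unfolding retract_of_space_def by (elim exE conjE) (rule that, assumption, erule bspec)
  have r': "continuous_map (subtopology (mtopology_of ?M) U) (mtopology_of (submetric ?M ?F)) r"
    using r(1) U(2) by (simp add: mtopology_of_submetric subtopology_subtopology Int_absorb1)
  have F: "?F \<subseteq> mspace ?M"
    using closedin_subset[OF closed] by simp
  have inj: "inj_on ?e (mspace Y)"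
  proof (rule inj_onI)
    fix x y assume "x \<in> mspace Y" "y \<in> mspace Y" "?e x = ?e y"
    then show "x = y"
      using isometry[of x y] isometry[of y y] by (simp add: mdist_self)
  qed
  define g where "g = inv_into (mspace Y) ?e"
  have g: "g (?e y) = y" if "y \<in> mspace Y" for y
    unfolding g_def using inj that by (rule inv_into_f_f)
  have g_cont: "continuous_map (mtopology_of (submetric ?M ?F)) (mtopology_of Y) g"
    unfolding continuous_map_mtopology_of_iff using g isometry by (force simp del: comp_apply)
  obtain \<epsilon> where \<epsilon>: "\<epsilon> > 0" "mball_of ?M (?e a) \<epsilon> \<subseteq> U"
    using U a unfolding openin_mtopology_of_iff by (meson imageI subsetD)
  show thesis
  proof (rule that[OF \<epsilon>(1)], intro ballI impI)
    fix y assume y: "y \<in> mspace Y" "mdist Y a y < \<epsilon>"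
    let ?c = "\<lambda>t. Inr (segment_map Y a y t) :: 'm + ('y \<Rightarrow> real)"
    have c0: "?c 0 = ?e a" and c1: "?c 1 = ?e y"
      by (simp_all add: segment_map_def)
    have lip: "mdist ?M (?c s) (?c t) \<le> \<bar>s - t\<bar> * mdist Y a y" for s t
      by (simp add: mdist_cone_metric supdist_segment_map a y)
    have cM: "?c t \<in> mspace ?M" if "t \<in> {0..1}" for t
      using that y by (auto simp: mspace_cone_metric)
    have cU: "?c t \<in> U" if t: "t \<in> {0..1}" for t
    proof -
      have "mdist ?M (?e a) (?c t) \<le> t * mdist Y a y"
        using lip[of 0 t] t unfolding c0 by simp
      also have "\<dots> \<le> mdist Y a y"
        using t by (simp add: mult_left_le_one_le)
      finally show ?thesis
        using \<epsilon>(2) y F a cM[OF t] by (force simp del: comp_apply)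
    qed
    have "continuous_map (mtopology_of (submetric euclidean_metric {0..1})) (mtopology_of ?M) ?c"
      unfolding continuous_map_mtopology_of_iff
    proof (intro conjI ballI allI impI)
      show "?c ` mspace (submetric euclidean_metric {0..1}) \<subseteq> mspace ?M"
        using cM by auto
      fix s \<eta> :: real
      assume "\<eta> > 0"
      have "mdist ?M (?c s) (?c t) \<le> \<bar>s - t\<bar>" for t
        using lip[of s t] bounded[OF a y(1)] mult_left_le[of "mdist Y a y" "\<bar>s - t\<bar>"] by linarith
      then show "\<exists>\<delta>>0. \<forall>t. t \<in> mspace (submetric euclidean_metric {0..1})
          \<and> mdist (submetric euclidean_metric {0..1}) s t < \<delta> \<longrightarrow> mdist ?M (?c s) (?c t) < \<eta>"
        using \<open>\<eta> > 0\<close> by (intro exI[of _ \<eta>]) (auto simp: dist_real_def intro: order_le_less_trans)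
    qed
    then have "continuous_map (subtopology euclideanreal {0..1}) (subtopology (mtopology_of ?M) U) ?c"
      using cU by (auto simp: mtopology_of_submetric continuous_map_in_subtopology)
    then have "continuous_map (subtopology euclideanreal {0..1}) (mtopology_of Y) (g \<circ> r \<circ> ?c)"
      using r' g_cont by (intro continuous_map_compose)
    then have "connectedin (mtopology_of Y) ((g \<circ> r \<circ> ?c) ` {0..1})"
      by (rule connectedin_continuous_map_image) (simp add: connectedin_subtopology)
    moreover have "(g \<circ> r \<circ> ?c) 0 = a" "(g \<circ> r \<circ> ?c) 1 = y"
      using c0 c1 r(2) g a y by (simp_all del: comp_apply add: comp_apply[of _ ?c] comp_apply[of g r])
    ultimately show "\<exists>S. connectedin (mtopology_of Y) S \<and> a \<in> S \<and> y \<in> S"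
      by (metis atLeastAtMost_iff image_eqI order.refl zero_le_one)
  qed
qed

section \<open>Norms that generate a linear topology\<close>

definition is_norm :: "('a::real_vector \<Rightarrow> real) \<Rightarrow> bool" where
  "is_norm n \<longleftrightarrow>
    (\<forall>x. n x \<ge> 0) \<and> (\<forall>x. n x = 0 \<longleftrightarrow> x = 0) \<and>
    (\<forall>c x. n (c *\<^sub>R x) = \<bar>c\<bar> * n x) \<and> (\<forall>x y. n (x + y) \<le> n x + n y)"

lemma is_norm_minus_commute:
  assumes "is_norm n" shows "n (x - y) = n (y - x)"
proof -
  have "n ((-1) *\<^sub>R (x - y)) = \<bar>-1\<bar> * n (x - y)"
    using assms unfolding is_norm_def by blast
  then show ?thesis by simp
qed

lemma is_norm_triangle:
  assumes "is_norm n" shows "n (x - z) \<le> n (x - y) + n (y - z)"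
proof -
  have "n ((x - y) + (y - z)) \<le> n (x - y) + n (y - z)"
    using assms unfolding is_norm_def by blast
  then show ?thesis by simp
qed

lemma is_norm_zero: "is_norm n \<Longrightarrow> n 0 = 0"
  unfolding is_norm_def by blast

lemma Metric_space_norm:
  assumes "is_norm n" shows "Metric_space UNIV (\<lambda>x y. n (x - y))"
proof
  show "n (x - y) = n (y - x)" for x y
    using assms by (rule is_norm_minus_commute)
  show "n (x - z) \<le> n (x - y) + n (y - z)" for x y z
    using assms by (rule is_norm_triangle)
qed (use assms in \<open>auto simp: is_norm_def\<close>)

lemma topology_eq_norm_topology_iff:
  fixes n :: "'a::topological_real_vector \<Rightarrow> real"
  assumes "is_norm n"
  shows "(euclidean :: 'a topology) = Metric_space.mtopology UNIV (\<lambda>x y. n (x - y)) \<longleftrightarrow>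
    (\<forall>S. open S \<longleftrightarrow> (\<forall>x\<in>S. \<exists>r>0. \<forall>y. n (x - y) < r \<longrightarrow> y \<in> S))"
proof -
  interpret Metric_space UNIV "\<lambda>x y. n (x - y)"
    using assms by (rule Metric_space_norm)
  show ?thesis
    unfolding topology_eq openin_mtopology by (simp add: subset_iff Ball_def)
qed

definition admissible_norm :: "('a::topological_real_vector \<Rightarrow> real) \<Rightarrow> bool" where
  "admissible_norm n \<longleftrightarrow> is_norm n \<and>
    (\<forall>S. open S \<longleftrightarrow> (\<forall>x\<in>S. \<exists>r>0. \<forall>y. n (x - y) < r \<longrightarrow> y \<in> S))"

lemma normable_iff: "normable TYPE('a::topological_real_vector) \<longleftrightarrow> (\<exists>n::'a \<Rightarrow> real. admissible_norm n)"
proof -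
  have "admissible_norm n \<longleftrightarrow> is_norm n \<and>
      (euclidean :: 'a topology) = Metric_space.mtopology UNIV (\<lambda>x y. n (x - y))" for n :: "'a \<Rightarrow> real"
    unfolding admissible_norm_def using topology_eq_norm_topology_iff[of n] by blast
  then show ?thesis
    by (simp only: normable_def is_norm_def conj_assoc)
qed

lemma admissible_norm_open_iff:
  assumes "admissible_norm n"
  shows "open S \<longleftrightarrow> (\<forall>x\<in>S. \<exists>r>0. \<forall>y. n (x - y) < r \<longrightarrow> y \<in> S)"
  using assms unfolding admissible_norm_def by (elim conjE) (rule spec)

section \<open>Minkowski functionals and bounded neighborhoods\<close>

lemma open_scaleR_vimage:
  fixes V :: "'a::topological_real_vector set"
  assumes "open V" shows "open ((\<lambda>x. c *\<^sub>R x) -` V)"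
proof (rule open_vimage[OF assms])
  have "((\<lambda>x. c *\<^sub>R x) \<longlongrightarrow> c *\<^sub>R x) (nhds x)" for x :: 'a
  proof -
    have "filterlim (\<lambda>y. (c, y)) (nhds c \<times>\<^sub>F nhds x) (nhds x)"
      by (intro filterlim_Pair tendsto_const filterlim_ident)
    from filterlim_compose[OF tendsto_scaleR_Pair this] show ?thesis by simp
  qed
  then show "continuous_on UNIV (\<lambda>x::'a. c *\<^sub>R x)"
    by (auto simp: continuous_on_def intro: tendsto_mono at_le at_within_le_nhds)
qed

lemma open_diff_vimage:
  fixes V :: "'a::topological_real_vector set"
  assumes "open V" shows "open ((\<lambda>x. a - x) -` V)"
proof -
  have "continuous_on UNIV (\<lambda>x. a + - x)"
    by (intro continuous_intros)
  then show ?thesis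
    by (intro open_vimage[OF assms]) simp
qed

text \<open>
  Continuity of the scaling \<open>s \<mapsto> s *\<^sub>R x\<close> at \<open>s = 0\<close> makes every neighborhood of the origin absorbing.
\<close>

lemma open_absorbing:
  fixes V :: "'a::topological_real_vector set"
  assumes "open V" "0 \<in> V"
  obtains t where "t > 0" "inverse t *\<^sub>R x \<in> V"
proof -
  have "filterlim (\<lambda>s. (s, x)) (nhds 0 \<times>\<^sub>F nhds x) (nhds (0::real))"
    by (intro filterlim_Pair tendsto_const filterlim_ident)
  from filterlim_compose[OF tendsto_scaleR_Pair this]
  have "((\<lambda>s. s *\<^sub>R x) \<longlongrightarrow> 0) (nhds (0::real))" by simp
  then have "eventually (\<lambda>s. s *\<^sub>R x \<in> V) (nhds (0::real))"
    using assms by (simp add: tendsto_def)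
  then obtain d where d: "d > 0" "\<And>s. dist s 0 < d \<Longrightarrow> s *\<^sub>R x \<in> V"
    by (auto simp: eventually_nhds_metric)
  show thesis
    by (rule that[of "2 / d"]) (use d in auto)
qed

lemma convex_scaleR_mem:
  assumes "convex V" "0 \<in> V" "x \<in> V" "0 \<le> c" "c \<le> (1::real)"
  shows "c *\<^sub>R x \<in> V"
  using convexD_alt[OF assms(1,2,3,4,5)] by simp

definition minkowski_gauge :: "'a::real_vector set \<Rightarrow> 'a \<Rightarrow> real" where
  "minkowski_gauge V x = Inf {t. t > 0 \<and> inverse t *\<^sub>R x \<in> V}"

text \<open>
  Boundedness in the sense of von Neumann. Only convex neighborhoods are tested, which gives the
  usual notion in a locally convex space.
\<close>

definition vbounded :: "'a::topological_real_vector set \<Rightarrow> bool" where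
  "vbounded B \<longleftrightarrow> (\<forall>W. open W \<and> 0 \<in> W \<and> convex W \<longrightarrow> (\<exists>k>0. \<forall>b\<in>B. inverse k *\<^sub>R b \<in> W))"

context
  fixes V :: "'a::topological_real_vector set"
  assumes V: "open V" "0 \<in> V" "convex V" and symmetric: "\<forall>x\<in>V. - x \<in> V"
begin

lemma minkowski_gauge_less_imp:
  assumes "minkowski_gauge V x < s" shows "s > 0" "inverse s *\<^sub>R x \<in> V"
proof -
  obtain t where "t > 0" "inverse t *\<^sub>R x \<in> V"
    by (rule open_absorbing[OF V(1,2)])
  then have ne: "{t. t > 0 \<and> inverse t *\<^sub>R x \<in> V} \<noteq> {}" by auto
  obtain t where t: "t > 0" "inverse t *\<^sub>R x \<in> V" "t < s"
    using cInf_lessD[OF ne assms[unfolded minkowski_gauge_def]] by auto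
  then show "s > 0" by simp
  have "(t / s) *\<^sub>R (inverse t *\<^sub>R x) \<in> V"
    using V(3,2) t(2) by (rule convex_scaleR_mem) (use t in auto)
  then show "inverse s *\<^sub>R x \<in> V"
    using t by (simp add: field_simps)
qed

lemma minkowski_gauge_le:
  assumes "s > 0" "inverse s *\<^sub>R x \<in> V" shows "minkowski_gauge V x \<le> s"
  unfolding minkowski_gauge_def using assms by (intro cInf_lower) (auto intro!: bdd_belowI[of _ 0])

lemma minkowski_gauge_nonneg: "minkowski_gauge V x \<ge> 0"
  using minkowski_gauge_less_imp(1)[of x 0] by force

lemma minkowski_gauge_scaleR_le: "minkowski_gauge V (c *\<^sub>R x) \<le> \<bar>c\<bar> * minkowski_gauge V x"
proof (cases "c = 0")
  case True
  have "minkowski_gauge V (0 :: 'a) \<le> e" if "e > 0" for e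
    using that V(2) by (intro minkowski_gauge_le) auto
  then show ?thesis
    using True by (auto intro: field_le_epsilon)
next
  case False
  show ?thesis
  proof (rule field_le_epsilon)
    fix e :: real assume "e > 0"
    let ?s = "minkowski_gauge V x + e / \<bar>c\<bar>"
    have "minkowski_gauge V x < ?s"
      using \<open>e > 0\<close> False by simp
    note s = minkowski_gauge_less_imp[OF this]
    have "inverse (\<bar>c\<bar> * ?s) *\<^sub>R (c *\<^sub>R x) = sgn c *\<^sub>R (inverse ?s *\<^sub>R x)"
      using False s(1) by (simp add: sgn_real_def divide_simps)
    also have "\<dots> \<in> V"
      using s(2) bspec[OF symmetric s(2)] False by (auto simp: sgn_real_def)
    finally have "minkowski_gauge V (c *\<^sub>R x) \<le> \<bar>c\<bar> * ?s"
      using s(1) False by (intro minkowski_gauge_le) auto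
    then show "minkowski_gauge V (c *\<^sub>R x) \<le> \<bar>c\<bar> * minkowski_gauge V x + e"
      using False by (simp add: distrib_left)
  qed
qed

lemma minkowski_gauge_scaleR: "minkowski_gauge V (c *\<^sub>R x) = \<bar>c\<bar> * minkowski_gauge V x"
proof (rule antisym)
  show "\<bar>c\<bar> * minkowski_gauge V x \<le> minkowski_gauge V (c *\<^sub>R x)"
  proof (cases "c = 0")
    case False
    have "minkowski_gauge V x \<le> \<bar>inverse c\<bar> * minkowski_gauge V (c *\<^sub>R x)"
      using minkowski_gauge_scaleR_le[of "inverse c" "c *\<^sub>R x"] False by simp
    then show ?thesis
      using False by (simp add: field_simps abs_inverse)
  qed (simp add: minkowski_gauge_nonneg)
qed (rule minkowski_gauge_scaleR_le)

lemma minkowski_gauge_triangle: "minkowski_gauge V (x + y) \<le> minkowski_gauge V x + minkowski_gauge V y"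
proof (rule field_le_epsilon)
  fix e :: real assume "e > 0"
  define s t where "s = minkowski_gauge V x + e / 2" and "t = minkowski_gauge V y + e / 2"
  have s: "s > 0" "inverse s *\<^sub>R x \<in> V"
    using minkowski_gauge_less_imp[of x s] \<open>e > 0\<close> by (auto simp: s_def)
  have t: "t > 0" "inverse t *\<^sub>R y \<in> V"
    using minkowski_gauge_less_imp[of y t] \<open>e > 0\<close> by (auto simp: t_def)
  have "s / (s + t) + t / (s + t) = 1"
    using s(1) t(1) by (simp add: add_divide_distrib[symmetric])
  then have "(s / (s + t)) *\<^sub>R (inverse s *\<^sub>R x) + (t / (s + t)) *\<^sub>R (inverse t *\<^sub>R y) \<in> V"
    using s(1) t(1) by (intro convexD[OF V(3) s(2) t(2)]) auto
  also have "(s / (s + t)) *\<^sub>R (inverse s *\<^sub>R x) = inverse (s + t) *\<^sub>R x"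
    using s(1) by (simp add: divide_inverse)
  also have "(t / (s + t)) *\<^sub>R (inverse t *\<^sub>R y) = inverse (s + t) *\<^sub>R y"
    using t(1) by (simp add: divide_inverse)
  finally have "minkowski_gauge V (x + y) \<le> s + t"
    using s(1) t(1) by (intro minkowski_gauge_le) (auto simp: scaleR_right_distrib)
  then show "minkowski_gauge V (x + y) \<le> minkowski_gauge V x + minkowski_gauge V y + e"
    by (simp add: s_def t_def)
qed

end

text \<open>
  Boundedness of \<open>V\<close> is what makes its Minkowski functional generate a topology as fine as the
  given one: the sets \<open>r V\<close> eventually enter every convex neighborhood of the origin.
\<close>

lemma small_minkowski_gauge_imp_mem:
  fixes V :: "'a::topological_real_vector set"
  assumes V: "open V" "0 \<in> V" "convex V" and symmetric: "\<forall>x\<in>V. - x \<in> V"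
    and "vbounded V" and W: "open W" "0 \<in> W" "convex W"
  obtains r where "r > 0" "\<And>x. minkowski_gauge V x < r \<Longrightarrow> x \<in> W"
proof -
  obtain k where k: "k > 0" "\<And>b. b \<in> V \<Longrightarrow> inverse k *\<^sub>R b \<in> W"
    using \<open>vbounded V\<close> W unfolding vbounded_def by blast
  show thesis
  proof (rule that[of "inverse k"])
    fix x assume "minkowski_gauge V x < inverse k"
    then have "inverse (inverse k) *\<^sub>R x \<in> V"
      by (rule minkowski_gauge_less_imp(2)[OF V symmetric])
    from k(2)[OF this] show "x \<in> W"
      using k(1) by simp
  qed (use k in simp)
qed

text \<open>
  The bounded neighborhood is shrunk to a convex and symmetric one, whose Minkowski functional is
  the desired norm. Definiteness comes from the points being closed together with boundedness, and
  comparing the topologies uses boundedness in one direction and openness in the other.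
\<close>

theorem Kolmogorov_normability:
  fixes N :: "'a::topological_real_vector set"
  assumes lc: "locally_convex TYPE('a)" and T1: "\<And>x::'a. closed {x}"
    and N: "open N" "0 \<in> N" and bounded: "vbounded N"
  shows "normable TYPE('a)"
proof -
  obtain V0 where V0: "open V0" "0 \<in> V0" "convex V0" "V0 \<subseteq> N"
    using lc[unfolded locally_convex_def, rule_format, of N] N by auto
  define V where "V = V0 \<inter> uminus -` V0"
  have "uminus -` V0 = (\<lambda>x. (-1) *\<^sub>R x) -` V0"
    by auto
  then have opV: "open V"
    unfolding V_def using V0(1) open_scaleR_vimage[of V0 "-1"] by auto
  have zV: "0 \<in> V" and convV: "convex V"
    using V0 by (auto simp: V_def intro!: convex_Int convex_linear_vimage linear_uminus linearI)
  have sym: "\<forall>x\<in>V. - x \<in> V"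
    by (auto simp: V_def)
  have bdV: "vbounded V"
    using bounded V0(4) unfolding vbounded_def V_def by fast
  note V = opV zV convV sym
  note g0 = minkowski_gauge_nonneg[OF V] and gs = minkowski_gauge_scaleR[OF V] and gt = minkowski_gauge_triangle[OF V]
  have small: "\<exists>r>0. \<forall>x. minkowski_gauge V x < r \<longrightarrow> x \<in> W" if W: "open W" "0 \<in> W" for W
  proof -
    obtain W' where W': "open W'" "0 \<in> W'" "convex W'" "W' \<subseteq> W"
      using lc[unfolded locally_convex_def, rule_format, of W] W by auto
    obtain r where "r > 0" "\<And>x. minkowski_gauge V x < r \<Longrightarrow> x \<in> W'"
      using small_minkowski_gauge_imp_mem[OF V bdV W'(1-3)] by blast
    then show ?thesis
      using W'(4) by (intro exI[of _ r]) blast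
  qed
  have "minkowski_gauge V x = 0 \<longleftrightarrow> x = 0" for x
  proof
    assume "minkowski_gauge V x = 0"
    show "x = 0"
    proof (rule ccontr)
      assume "x \<noteq> 0"
      then obtain r where "r > 0" "\<forall>y. minkowski_gauge V y < r \<longrightarrow> y \<noteq> x"
        using small[of "- {x}"] T1[of x] by auto
      then show False
        using \<open>minkowski_gauge V x = 0\<close> by (auto dest: spec[of _ x])
    qed
  next
    assume "x = 0"
    then show "minkowski_gauge V x = 0"
      using gs[of 0 0] by simp
  qed
  then have norm: "is_norm (minkowski_gauge V)"
    using g0 gs gt unfolding is_norm_def by simp
  have "open S \<longleftrightarrow> (\<forall>x\<in>S. \<exists>r>0. \<forall>y. minkowski_gauge V (x - y) < r \<longrightarrow> y \<in> S)" for S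
  proof (intro iffI ballI)
    fix x assume "open S" "x \<in> S"
    then obtain r where "r > 0" "\<And>z. minkowski_gauge V z < r \<Longrightarrow> z \<in> (\<lambda>z. x - z) -` S"
      using small[of "(\<lambda>z. x - z) -` S"] open_diff_vimage[of S x] by auto
    then show "\<exists>r>0. \<forall>y. minkowski_gauge V (x - y) < r \<longrightarrow> y \<in> S"
      by (intro exI[of _ r]) force
  next
    assume *: "\<forall>x\<in>S. \<exists>r>0. \<forall>y. minkowski_gauge V (x - y) < r \<longrightarrow> y \<in> S"
    show "open S"
    proof (subst open_subopen, intro ballI)
      fix x assume "x \<in> S"
      then obtain r where r: "r > 0" "\<And>y. minkowski_gauge V (x - y) < r \<Longrightarrow> y \<in> S"
        using * by blast
      let ?T = "(\<lambda>y. x - y) -` ((\<lambda>z. (2 / r) *\<^sub>R z) -` V)"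
      have "y \<in> S" if "y \<in> ?T" for y
      proof -
        have "minkowski_gauge V (x - y) \<le> r / 2"
          using that r(1) by (intro minkowski_gauge_le[OF V]) auto
        then show ?thesis using r by auto
      qed
      moreover have "open ?T" "x \<in> ?T"
        using opV zV by (auto intro: open_diff_vimage open_scaleR_vimage)
      ultimately show "\<exists>T. open T \<and> x \<in> T \<and> T \<subseteq> S"
        by blast
    qed
  qed
  then have "admissible_norm (minkowski_gauge V)"
    unfolding admissible_norm_def by (intro conjI allI norm)
  then show ?thesis
    unfolding normable_iff by (rule exI[of admissible_norm])
qed

section \<open>The linear uniformity and the Hausdorff distance\<close>

lemma generates_linear_uniformity_diff:
  fixes d :: "'a::topological_real_vector metric"
  assumes d: "generates_linear_uniformity d" and W: "open W" "0 \<in> W"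
  obtains e where "e > 0" "\<And>x y. mdist d x y < e \<Longrightarrow> x - y \<in> W"
proof -
  have "eventually (\<lambda>(x, y). x - y \<in> W) linear_uniformity"
    unfolding linear_uniformity_def
    using W by (intro eventually_INF1[of W]) (auto simp: eventually_principal)
  then have "eventually (\<lambda>(x, y). x - y \<in> W) (INF e\<in>{0<..}. principal {(x, y). mdist d x y < e})"
    using d by (simp add: generates_linear_uniformity_def)
  then show thesis
    using that by (subst (asm) eventually_INF_base)
      (auto simp: eventually_principal subset_eq intro: bexI[of _ "min _ _"])
qed

lemma generates_linear_uniformity_mdist:
  fixes d :: "'a::topological_real_vector metric"
  assumes d: "generates_linear_uniformity d" and "e > 0"
  obtains W where "open W" "0 \<in> W" "\<And>x y. x - y \<in> W \<Longrightarrow> mdist d x y < e"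
proof -
  have "eventually (\<lambda>(x, y). mdist d x y < e) (INF e\<in>{0<..}. principal {(x, y). mdist d x y < e})"
    using \<open>e > 0\<close> by (intro eventually_INF1[of e]) (auto simp: eventually_principal)
  then have ev: "eventually (\<lambda>(x, y). mdist d x y < e) (linear_uniformity :: ('a \<times> 'a) filter)"
    using d by (simp add: generates_linear_uniformity_def)
  have "\<exists>W\<in>{W. open W \<and> 0 \<in> W}. eventually (\<lambda>(x, y). mdist d x y < e) (principal {(x, y). x - y \<in> W})"
    using ev unfolding linear_uniformity_def
  proof (subst (asm) eventually_INF_base)
    fix U V :: "'a set"
    assume "U \<in> {W. open W \<and> 0 \<in> W}" "V \<in> {W. open W \<and> 0 \<in> W}"
    then show "\<exists>W\<in>{W. open W \<and> 0 \<in> W}. principal {(x, y). x - y \<in> W}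
        \<le> inf (principal {(x, y). x - y \<in> U}) (principal {(x, y). x - y \<in> V})"
      by (intro bexI[of _ "U \<inter> V"]) auto
  qed auto
  then show thesis
    using that by (auto simp: eventually_principal)
qed

lemma admissible_norm_ball:
  fixes n :: "'a::topological_real_vector \<Rightarrow> real"
  assumes n: "admissible_norm n" and "e > 0"
  shows "open {x. n x < e}" "0 \<in> {x. n x < e}"
proof -
  have norm: "is_norm n" using n by (simp add: admissible_norm_def)
  show "0 \<in> {x. n x < e}"
    using is_norm_zero[OF norm] \<open>e > 0\<close> by simp
  have "\<exists>r>0. \<forall>y. n (x - y) < r \<longrightarrow> y \<in> {x. n x < e}" if "x \<in> {x. n x < e}" for x
  proof (intro exI[of _ "e - n x"] conjI allI impI)
    fix y assume "n (x - y) < e - n x"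
    then show "y \<in> {x. n x < e}"
      using is_norm_triangle[OF norm, of y 0 x] is_norm_minus_commute[OF norm, of x y] by simp
  qed (use that in simp)
  then show "open {x. n x < e}"
    using n unfolding admissible_norm_def by blast
qed

lemma admissible_norm_nhd:
  fixes n :: "'a::topological_real_vector \<Rightarrow> real"
  assumes n: "admissible_norm n" and "open W" "0 \<in> W"
  obtains e where "e > 0" "\<And>x. n x < e \<Longrightarrow> x \<in> W"
proof -
  have norm: "is_norm n" using n by (simp add: admissible_norm_def)
  obtain e where "e > 0" "\<And>y. n (0 - y) < e \<Longrightarrow> y \<in> W"
    using assms unfolding admissible_norm_def by blast
  then show thesis
    using that[of e] is_norm_minus_commute[OF norm, of 0] by simp
qed

lemma mdist_hyperspace_le_1:
  fixes d :: "'a::topological_real_vector metric"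
  assumes "generates_linear_uniformity d"
  shows "mdist (hyperspace d) A B \<le> 1"
proof -
  have "enn2real (min 1 (hausdorff_dist d A B)) \<le> enn2real 1"
    by (rule enn2real_mono) auto
  then show ?thesis
    by (simp add: mdist_hyperspace[OF assms])
qed

text \<open>
  The bound \<open>s \<le> 1\<close> keeps the distance below the level at which the hyperspace metric is cut off,
  so that the Hausdorff distance itself is below \<open>s\<close>.
\<close>

lemma mdist_hyperspace_less_imp:
  fixes d :: "'a::topological_real_vector metric"
  assumes d: "generates_linear_uniformity d"
    and less: "mdist (hyperspace d) A B < s" "s \<le> 1" and "a \<in> A"
  obtains b where "b \<in> B" "mdist d a b < s"
proof -
  have fin: "min 1 (hausdorff_dist d A B) < top"
    by (simp add: min_less_iff_disj)
  have s: "enn2real (min 1 (hausdorff_dist d A B)) < s"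
    using less(1) by (simp add: mdist_hyperspace[OF d])
  have "0 < s"
    using s enn2real_nonneg by (rule order_le_less_trans[rotated])
  have "min 1 (hausdorff_dist d A B) = ennreal (enn2real (min 1 (hausdorff_dist d A B)))"
    using fin by simp
  also have "\<dots> < ennreal s"
    using s \<open>0 < s\<close> by (intro ennreal_lessI)
  finally have "hausdorff_dist d A B < ennreal s"
    using less(2) ennreal_leI[OF less(2)] by (auto simp: min_less_iff_disj)
  moreover have "(INF b\<in>B. ennreal (mdist d a b)) \<le> (SUP x\<in>A. INF b\<in>B. ennreal (mdist d x b))"
    using \<open>a \<in> A\<close> by (rule SUP_upper)
  ultimately have "(INF b\<in>B. ennreal (mdist d a b)) < ennreal s"
    unfolding hausdorff_dist_def by (meson le_less_trans max.cobounded2)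
  then obtain b where "b \<in> B" "ennreal (mdist d a b) < ennreal s"
    unfolding INF_less_iff by blast
  then show thesis
    using that by (simp add: ennreal_less_iff)
qed

lemma mdist_hyperspace_le:
  fixes d :: "'a::topological_real_vector metric"
  assumes d: "generates_linear_uniformity d" and "0 \<le> s"
    and AB: "\<And>a. a \<in> A \<Longrightarrow> \<exists>b\<in>B. mdist d a b \<le> s"
    and BA: "\<And>b. b \<in> B \<Longrightarrow> \<exists>a\<in>A. mdist d b a \<le> s"
  shows "mdist (hyperspace d) A B \<le> s"
proof -
  have excess: "(SUP x\<in>P. INF y\<in>Q. ennreal (mdist d x y)) \<le> ennreal s"
    if "\<And>x. x \<in> P \<Longrightarrow> \<exists>y\<in>Q. mdist d x y \<le> s" for P Q
    using that by (intro SUP_least) (meson INF_lower2 ennreal_leI)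
  have "hausdorff_dist d A B \<le> ennreal s"
    unfolding hausdorff_dist_def using excess[OF AB] excess[OF BA] by simp
  then have "min 1 (hausdorff_dist d A B) \<le> ennreal s"
    by (rule min.coboundedI2)
  then have "enn2real (min 1 (hausdorff_dist d A B)) \<le> enn2real (ennreal s)"
    by (rule enn2real_mono) simp
  then show ?thesis
    using \<open>0 \<le> s\<close> by (simp add: mdist_hyperspace[OF d])
qed

lemma norm_uniform:
  fixes d :: "'a::topological_real_vector metric" and n :: "'a \<Rightarrow> real"
  assumes d: "generates_linear_uniformity d" and n: "admissible_norm n" and "e > 0"
  shows norm_small_if_mdist_small: "\<exists>\<delta>>0. \<forall>x y. mdist d x y < \<delta> \<longrightarrow> n (x - y) < e"
    and mdist_small_if_norm_small: "\<exists>\<delta>>0. \<forall>x y. n (x - y) < \<delta> \<longrightarrow> mdist d x y < e"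
proof -
  obtain \<delta> where "\<delta> > 0" "\<And>x y. mdist d x y < \<delta> \<Longrightarrow> x - y \<in> {x. n x < e}"
    by (rule generates_linear_uniformity_diff[OF d admissible_norm_ball[OF n \<open>e > 0\<close>]]) blast
  then show "\<exists>\<delta>>0. \<forall>x y. mdist d x y < \<delta> \<longrightarrow> n (x - y) < e"
    by (intro exI[of _ \<delta>]) simp
  obtain W where W: "open W" "0 \<in> W" "\<And>x y. x - y \<in> W \<Longrightarrow> mdist d x y < e"
    using generates_linear_uniformity_mdist[OF d \<open>e > 0\<close>] by blast
  obtain \<delta> where "\<delta> > 0" "\<And>x. n x < \<delta> \<Longrightarrow> x \<in> W"
    using admissible_norm_nhd[OF n W(1,2)] by blast
  then show "\<exists>\<delta>>0. \<forall>x y. n (x - y) < \<delta> \<longrightarrow> mdist d x y < e"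
    using W(3) by (intro exI[of _ \<delta>]) simp
qed

section \<open>Boundedness in connected parts of the hyperspace\<close>

text \<open>
  With \<open>b \<in> k W\<close> and \<open>a - b \<in> W\<close>, the sum \<open>a\<close> lies in \<open>k W + W\<close>, which is \<open>(k + 1) W\<close> for convex \<open>W\<close>.
\<close>

lemma bounded_near_bounded:
  fixes W :: "'a::real_vector set"
  assumes W: "convex W" and k: "k > 0" "inverse k *\<^sub>R b \<in> W" and "a - b \<in> W"
  shows "inverse (k + 1) *\<^sub>R a \<in> W"
proof -
  have "k / (k + 1) + 1 / (k + 1) = 1"
    using k(1) by (simp add: add_divide_distrib[symmetric])
  then have "(k / (k + 1)) *\<^sub>R (inverse k *\<^sub>R b) + (1 / (k + 1)) *\<^sub>R (a - b) \<in> W"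
    using k(1) by (intro convexD[OF W k(2) \<open>a - b \<in> W\<close>]) auto
  also have "(k / (k + 1)) *\<^sub>R (inverse k *\<^sub>R b) = inverse (k + 1) *\<^sub>R b"
    using k(1) by (simp add: divide_inverse)
  finally show ?thesis
    by (simp add: divide_inverse scaleR_right_diff_distrib)
qed

text \<open>
  For a convex neighborhood \<open>W\<close> of the origin, a closed set at small Hausdorff distance from
  a set inside \<open>k W\<close> is inside \<open>(k + 1) W\<close>. The admissible distance does not depend on \<open>k\<close>, so the
  sets absorbed by \<open>W\<close> are both open and closed in the hyperspace, and \<open>{0}\<close> is one of them.
\<close>

lemma connected_hyperspace_bounded:
  fixes d :: "'a::topological_real_vector metric"
  assumes d: "generates_linear_uniformity d"
    and S: "connectedin (mtopology_of (hyperspace d)) S" "{0} \<in> S" "B \<in> S"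
  shows "vbounded B"
  unfolding vbounded_def
proof (intro allI impI)
  fix W :: "'a set" assume W: "open W \<and> 0 \<in> W \<and> convex W"
  let ?Y = "hyperspace d"
  define C where "C = {A\<in>mspace ?Y. \<exists>k>0. \<forall>a\<in>A. inverse k *\<^sub>R a \<in> W}"
  obtain \<delta> where \<delta>: "\<delta> > 0" "\<And>x y. mdist d x y < \<delta> \<Longrightarrow> x - y \<in> W"
    using generates_linear_uniformity_diff[OF d, of W] W by blast
  have near: "A' \<in> C" if A: "A \<in> C" "A' \<in> mspace ?Y" "mdist ?Y A A' < min \<delta> 1" for A A'
  proof -
    obtain k where k: "k > 0" "\<And>a. a \<in> A \<Longrightarrow> inverse k *\<^sub>R a \<in> W"
      using A(1) by (auto simp: C_def)
    have "inverse (k + 1) *\<^sub>R a \<in> W" if a: "a \<in> A'" for a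
    proof -
      have "mdist ?Y A' A < min \<delta> 1"
        using A(3) by (simp add: mdist_commute)
      then obtain b where "b \<in> A" "mdist d a b < min \<delta> 1"
        using mdist_hyperspace_less_imp[OF d _ _ a] by (metis min.cobounded2)
      then show ?thesis
        using W k(2) \<delta>(2)[of a b] by (intro bounded_near_bounded[OF _ k(1), of W b]) auto
    qed
    then show ?thesis
      using A(2) k(1) unfolding C_def by (intro CollectI conjI exI[of _ "k + 1"]) auto
  qed
  have pos: "min \<delta> 1 > 0" using \<delta>(1) by simp
  have CY: "C \<subseteq> mspace ?Y" by (auto simp: C_def)
  have opC: "openin (mtopology_of ?Y) C"
    unfolding openin_mtopology_of_iff
  proof (intro conjI ballI CY)
    fix A assume "A \<in> C"
    then show "\<exists>r>0. mball_of ?Y A r \<subseteq> C"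
      using near pos by (intro exI[of _ "min \<delta> 1"]) (auto simp del: min_less_iff_conj)
  qed
  have clC: "closedin (mtopology_of ?Y) C"
    unfolding closedin_mtopology_of_iff
  proof (intro conjI ballI CY exI[of _ "min \<delta> 1"] pos)
    fix A A' assume "A \<in> mspace ?Y - C" "A' \<in> C"
    then show "min \<delta> 1 \<le> mdist ?Y A A'"
      using near[of A' A] by (force simp: mdist_commute not_less[symmetric] simp del: min_less_iff_conj)
  qed
  have "{0} \<in> mspace ?Y"
    using connectedin_subset_topspace[OF S(1)] S(2) by auto
  then have "{0} \<in> C"
    using W by (auto simp: C_def intro: exI[of _ 1])
  then have "B \<in> C"
    using connectedin_clopen_cases[OF S(1) clC opC] S(2,3) by (auto simp: disjnt_iff)
  then show "\<exists>k>0. \<forall>b\<in>B. inverse k *\<^sub>R b \<in> W"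
    by (auto simp: C_def)
qed

text \<open>
  The closure of a small neighborhood \<open>N\<close> of the origin is a point of the hyperspace close to \<open>{0}\<close>,
  no matter whether \<open>N\<close> is bounded. Local connectedness at \<open>{0}\<close> then forces it to be bounded.
\<close>

theorem ANR_hyperspace_imp_normable:
  fixes d :: "'a::topological_real_vector metric"
  assumes lc: "locally_convex TYPE('a)" and d: "generates_linear_uniformity d"
    and closed_singleton: "\<And>x::'a. closed {x}"
    and ANR: "metric_ANR TYPE('m + ('a set \<Rightarrow> real)) (hyperspace d)"
  shows "normable TYPE('a)"
proof -
  have zero: "{0} \<in> mspace (hyperspace d)"
    using closed_singleton by (simp add: mspace_hyperspace[OF d])
  obtain \<epsilon> where \<epsilon>: "\<epsilon> > 0" "\<forall>A\<in>mspace (hyperspace d). mdist (hyperspace d) {0} A < \<epsilon> \<longrightarrow>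
      (\<exists>S. connectedin (mtopology_of (hyperspace d)) S \<and> {0} \<in> S \<and> A \<in> S)"
    by (rule ANR_locally_connected[OF ANR mdist_hyperspace_le_1[OF d] zero])
  have "\<epsilon> / 3 > 0" using \<epsilon>(1) by simp
  then obtain N where N: "open N" "0 \<in> N" "\<And>x y. x - y \<in> N \<Longrightarrow> mdist d x y < \<epsilon> / 3"
    using generates_linear_uniformity_mdist[OF d] by blast
  let ?B = "closure N"
  have "mdist d b 0 \<le> 2 * \<epsilon> / 3" if b: "b \<in> ?B" for b
  proof -
    have "open ((\<lambda>w. b - w) -` N)" "b \<in> (\<lambda>w. b - w) -` N"
      using open_diff_vimage[OF N(1)] N(2) by auto
    then obtain w where "w \<in> N" "b - w \<in> N"
      using b open_Int_closure_eq_empty[of "(\<lambda>w. b - w) -` N" N] by blast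
    then have "mdist d b w < \<epsilon> / 3" "mdist d w 0 < \<epsilon> / 3"
      using N(3) by auto
    then show ?thesis
      using mdist_triangle[of b d w 0] d by (simp add: generates_linear_uniformity_def)
  qed
  moreover have "0 \<in> ?B" using N(2) closure_subset by blast
  ultimately have "mdist (hyperspace d) {0} ?B \<le> 2 * \<epsilon> / 3"
    using \<epsilon>(1) d by (intro mdist_hyperspace_le[OF d])
      (auto intro!: bexI[of _ 0] simp: mdist_self generates_linear_uniformity_def)
  moreover have "?B \<in> mspace (hyperspace d)"
    using \<open>0 \<in> ?B\<close> by (auto simp: mspace_hyperspace[OF d])
  ultimately obtain S where "connectedin (mtopology_of (hyperspace d)) S" "{0} \<in> S" "?B \<in> S"
    using \<epsilon>(1) bspec[OF \<epsilon>(2), of ?B] by auto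
  then have "vbounded ?B"
    by (rule connected_hyperspace_bounded[OF d])
  then have "vbounded N"
    using closure_subset[of N] unfolding vbounded_def by fast
  with lc closed_singleton N(1,2) show ?thesis
    by (rule Kolmogorov_normability)
qed

section \<open>Concave moduli of continuity\<close>

text \<open>
  A concave modulus of continuity that controls \<open>q\<close> by \<open>p\<close>: the infimum of the affine functions \<open>l\<close>
  with \<open>l 0 \<ge> 0\<close>, slope at least 1, and \<open>q b \<le> l (p b)\<close> for all
  \<open>b\<close>. Concavity makes it subadditive, so it turns a metric into a metric. The bound on the slopes
  gives \<open>s \<le> modulus q p s\<close> for \<open>s \<ge> 0\<close>, so the new metric is not smaller than the old one.
\<close>

definition modulus :: "('b \<Rightarrow> real) \<Rightarrow> ('b \<Rightarrow> real) \<Rightarrow> real \<Rightarrow> real" where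
  "modulus q p s = Inf {\<alpha> + \<beta> * s |\<alpha> \<beta>. 0 \<le> \<alpha> \<and> 1 \<le> \<beta> \<and> (\<forall>b. q b \<le> \<alpha> + \<beta> * p b)}"

context
  fixes p q :: "'b \<Rightarrow> real"
  assumes p: "\<And>b. 0 \<le> p b" and q: "\<And>b. q b \<le> 1"
begin

lemma modulus_le:
  assumes "0 \<le> \<alpha>" "1 \<le> \<beta>" "\<forall>b. q b \<le> \<alpha> + \<beta> * p b" "0 \<le> s"
  shows "modulus q p s \<le> \<alpha> + \<beta> * s"
  unfolding modulus_def using assms
  by (intro cInf_lower) (auto intro!: bdd_belowI[of _ 0] add_nonneg_nonneg mult_nonneg_nonneg)

lemma modulus_approx:
  assumes "modulus q p s < c"
  obtains \<alpha> \<beta> where "0 \<le> \<alpha>" "1 \<le> \<beta>" "\<forall>b. q b \<le> \<alpha> + \<beta> * p b" "\<alpha> + \<beta> * s < c"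
proof -
  have "\<forall>b. q b \<le> 1 + 1 * p b"
    using p q by (auto intro: add_increasing2)
  then have "1 + 1 * s \<in> {\<alpha> + \<beta> * s |\<alpha> \<beta>. 0 \<le> \<alpha> \<and> 1 \<le> \<beta> \<and> (\<forall>b. q b \<le> \<alpha> + \<beta> * p b)}"
    by (intro CollectI exI[of _ 1]) auto
  then have ne: "{\<alpha> + \<beta> * s |\<alpha> \<beta>. 0 \<le> \<alpha> \<and> 1 \<le> \<beta> \<and> (\<forall>b. q b \<le> \<alpha> + \<beta> * p b)} \<noteq> {}"
    by blast
  show thesis
    using cInf_lessD[OF ne assms[unfolded modulus_def]] that by blast
qed

lemma modulus_ge:
  assumes "0 \<le> s" shows "s \<le> modulus q p s"
proof (rule ccontr)
  assume "\<not> s \<le> modulus q p s"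
  then have "modulus q p s < s" by simp
  then obtain \<alpha> \<beta> where "0 \<le> \<alpha>" "1 \<le> \<beta>" "\<alpha> + \<beta> * s < s"
    by (rule modulus_approx)
  then show False
    using mult_right_mono[of 1 \<beta> s] assms by simp
qed

lemma modulus_mono:
  assumes "0 \<le> s" "s \<le> t" shows "modulus q p s \<le> modulus q p t"
proof (rule field_le_epsilon)
  fix e :: real assume "e > 0"
  then have "modulus q p t < modulus q p t + e" by simp
  then obtain \<alpha> \<beta> where ab: "0 \<le> \<alpha>" "1 \<le> \<beta>" "\<forall>b. q b \<le> \<alpha> + \<beta> * p b" "\<alpha> + \<beta> * t < modulus q p t + e"
    by (rule modulus_approx)
  have "modulus q p s \<le> \<alpha> + \<beta> * s"
    using ab(1-3) assms(1) by (rule modulus_le)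
  also have "\<dots> \<le> \<alpha> + \<beta> * t"
    using ab(2) assms(2) by (simp add: mult_left_mono)
  finally show "modulus q p s \<le> modulus q p t + e"
    using ab(4) by simp
qed

text \<open>
  For almost optimal affine functions at \<open>s\<close> and at \<open>t\<close>, the one of smaller slope, used at \<open>s + t\<close>,
  already stays below the sum of the two values.
\<close>

lemma modulus_subadditive:
  assumes "0 \<le> s" "0 \<le> t" shows "modulus q p (s + t) \<le> modulus q p s + modulus q p t"
proof (rule field_le_epsilon)
  fix e :: real assume "e > 0"
  have "modulus q p s < modulus q p s + e / 2" using \<open>e > 0\<close> by simp
  then obtain \<alpha> \<beta> where ab: "0 \<le> \<alpha>" "1 \<le> \<beta>" "\<forall>b. q b \<le> \<alpha> + \<beta> * p b" "\<alpha> + \<beta> * s < modulus q p s + e / 2"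
    by (rule modulus_approx)
  have "modulus q p t < modulus q p t + e / 2" using \<open>e > 0\<close> by simp
  then obtain \<alpha>' \<beta>' where ab': "0 \<le> \<alpha>'" "1 \<le> \<beta>'" "\<forall>b. q b \<le> \<alpha>' + \<beta>' * p b" "\<alpha>' + \<beta>' * t < modulus q p t + e / 2"
    by (rule modulus_approx)
  have "modulus q p (s + t) \<le> \<alpha> + \<beta> * (s + t)" "modulus q p (s + t) \<le> \<alpha>' + \<beta>' * (s + t)"
    using ab(1-3) ab'(1-3) assms by (auto intro: modulus_le)
  moreover have "\<beta> * t \<le> \<beta>' * t \<or> \<beta>' * s \<le> \<beta> * s"
    using assms by (metis linear mult_right_mono)
  ultimately show "modulus q p (s + t) \<le> modulus q p s + modulus q p t + e"
    using ab(1,4) ab'(1,4) by (auto simp: distrib_left)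
qed

text \<open>
  If \<open>q \<le> e / 2\<close> wherever \<open>p < \<rho>\<close>, then the line with value \<open>e / 2\<close> at 0 and slope at least \<open>1 / \<rho>\<close>
  majorizes \<open>q\<close>, because it exceeds the bound 1 of \<open>q\<close> from \<open>\<rho>\<close> on.
\<close>

lemma modulus_small:
  assumes uniform: "\<And>e. e > 0 \<Longrightarrow> \<exists>\<delta>>0. \<forall>b. p b < \<delta> \<longrightarrow> q b \<le> e" and "e > 0"
  obtains \<delta> where "\<delta> > 0" "\<And>s. 0 \<le> s \<Longrightarrow> s < \<delta> \<Longrightarrow> modulus q p s < e"
proof -
  obtain \<rho> where \<rho>: "\<rho> > 0" "\<And>b. p b < \<rho> \<Longrightarrow> q b \<le> e / 2"
    using uniform[of "e / 2"] \<open>e > 0\<close> by auto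
  define \<beta> where "\<beta> = max 1 (1 / \<rho>)"
  have \<beta>: "1 \<le> \<beta>" "1 \<le> \<beta> * \<rho>"
    using \<rho>(1) by (auto simp: \<beta>_def max_def field_simps)
  have "q b \<le> e / 2 + \<beta> * p b" for b
  proof (cases "p b < \<rho>")
    case True
    then show ?thesis using \<rho>(2)[OF True] p[of b] \<beta>(1) by (simp add: add_increasing2)
  next
    case False
    then have "\<beta> * \<rho> \<le> \<beta> * p b" using \<beta>(1) by (intro mult_left_mono) auto
    then show ?thesis using \<beta>(2) q[of b] \<open>e > 0\<close> by simp
  qed
  then have le: "modulus q p s \<le> e / 2 + \<beta> * s" if "0 \<le> s" for s
    using \<open>e > 0\<close> \<beta>(1) that by (intro modulus_le) auto
  show thesis
  proof (rule that[of "e / (2 * \<beta>)"])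
    show "e / (2 * \<beta>) > 0" using \<open>e > 0\<close> \<beta>(1) by simp
    fix s assume s: "0 \<le> s" "s < e / (2 * \<beta>)"
    then have "\<beta> * s < e / 2"
      using \<beta>(1) by (simp add: field_simps)
    then show "modulus q p s < e" using le[OF s(1)] by simp
  qed
qed

end

section \<open>Extending maps into a hyperspace\<close>

text \<open>
  Here \<open>D\<close> is a pseudometric on \<open>S\<close> with a closed subset \<open>F\<close>, and \<open>g\<close> assigns to the points of \<open>F\<close>
  sets in a normed space. By symmetry of \<open>D\<close>, the last assumption says that \<open>g\<close> does not
  increase distances below 1 when sets are compared by the Hausdorff distance of \<open>n\<close>. The
  scale is limited because the Hausdorff distance of sets that are far apart may be infinite.
\<close>

locale hyperspace_extension =
  fixes n :: "'a::real_vector \<Rightarrow> real" and D :: "'m \<Rightarrow> 'm \<Rightarrow> real"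
    and S F :: "'m set" and g :: "'m \<Rightarrow> 'a set"
  assumes norm: "is_norm n"
    and D_nonneg: "0 \<le> D x y"
    and D_self: "x \<in> S \<Longrightarrow> D x x = 0"
    and D_commute: "D x y = D y x"
    and D_triangle: "x \<in> S \<Longrightarrow> y \<in> S \<Longrightarrow> z \<in> S \<Longrightarrow> D x z \<le> D x y + D y z"
    and F: "F \<subseteq> S" "F \<noteq> {}"
    and F_closed: "x \<in> S \<Longrightarrow> (INF a\<in>F. D x a) = 0 \<Longrightarrow> x \<in> F"
    and g_nonempty: "a \<in> F \<Longrightarrow> g a \<noteq> {}"
    and g_close: "a \<in> F \<Longrightarrow> b \<in> F \<Longrightarrow> D a b < c \<Longrightarrow> c \<le> 1 \<Longrightarrow> u \<in> g a \<Longrightarrow> \<exists>w\<in>g b. n (u - w) < c"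
begin

definition gap :: "'m \<Rightarrow> real" where
  "gap x = (INF a\<in>F. D x a)"

text \<open>
  The sublevel set at height \<open>12 * gap x\<close> of the function
  \<open>y \<mapsto> inf {n (y - z) + 3 * D x a | a \<in> F, z \<in> g a}\<close>, the infimum being written out. The weight 3 makes the
  penalty \<open>3 * D x a\<close> outgrow the distance between \<open>g a\<close> and \<open>g b\<close> for points \<open>b \<in> F\<close> nearer to \<open>x\<close>. The
  height 12 is twice the penalty \<open>3 * (2 * gap x)\<close> that some point of \<open>F\<close> is sure not to exceed.
\<close>

definition extension :: "'m \<Rightarrow> 'a set" where
  "extension x = {y. \<forall>\<epsilon>>0. \<exists>a\<in>F. \<exists>z\<in>g a. n (y - z) + 3 * D x a < 12 * gap x + \<epsilon>}"

lemma n_nonneg: "0 \<le> n x"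
  using norm by (simp add: is_norm_def)

lemma n_zero: "n 0 = 0"
  using norm by (simp add: is_norm_def)

lemma n_scaleR: "n (c *\<^sub>R x) = \<bar>c\<bar> * n x"
  using norm by (simp add: is_norm_def)

lemma gap_le: "a \<in> F \<Longrightarrow> gap x \<le> D x a"
  unfolding gap_def by (rule cINF_lower) (auto intro: bdd_belowI2[of _ 0] D_nonneg)

lemma gap_nonneg: "0 \<le> gap x"
  unfolding gap_def using F(2) by (rule cINF_greatest) (rule D_nonneg)

lemma gap_approx:
  assumes "e > 0"
  obtains a where "a \<in> F" "D x a < gap x + e"
proof -
  have "Inf (D x ` F) < gap x + e"
    using assms by (simp add: gap_def)
  then show thesis
    using cInf_lessD[of "D x ` F" "gap x + e"] F(2) that by blast
qed

lemma gap_triangle: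
  assumes "x \<in> S" "y \<in> S" shows "gap x \<le> D x y + gap y"
proof (rule field_le_epsilon)
  fix e :: real assume "e > 0"
  then obtain a where "a \<in> F" "D y a < gap y + e" by (rule gap_approx)
  then show "gap x \<le> D x y + gap y + e"
    using gap_le[of a x] D_triangle[OF assms, of a] F(1) by fastforce
qed

lemma gap_eq_0: "a \<in> F \<Longrightarrow> gap a = 0"
  using gap_le[of a a] gap_nonneg[of a] D_self[of a] F(1) by auto

lemma near_point:
  assumes "x \<in> S"
  obtains a where "a \<in> F" "D x a \<le> 2 * gap x"
proof (cases "gap x = 0")
  case True
  then have "x \<in> F" using assms F_closed by (simp add: gap_def)
  then show thesis using that[of x] True D_self[OF assms] by simp
next
  case False
  then have "gap x > 0" using gap_nonneg[of x] by simp
  then obtain a where "a \<in> F" "D x a < gap x + gap x" by (rule gap_approx)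
  then show thesis using that[of a] by simp
qed

lemma extension_memI:
  assumes "a \<in> F" "z \<in> g a" "n (y - z) + 3 * D x a \<le> 12 * gap x"
  shows "y \<in> extension x"
  unfolding extension_def
proof (intro CollectI allI impI)
  fix \<epsilon> :: real assume "\<epsilon> > 0"
  then have "n (y - z) + 3 * D x a < 12 * gap x + \<epsilon>"
    using assms(3) by linarith
  then show "\<exists>a\<in>F. \<exists>z\<in>g a. n (y - z) + 3 * D x a < 12 * gap x + \<epsilon>"
    using assms(1,2) by blast
qed

lemma extension_nonempty:
  assumes "x \<in> S"
  shows "extension x \<noteq> {}"
proof -
  obtain a where a: "a \<in> F" "D x a \<le> 2 * gap x"
    using near_point[OF assms] .
  obtain z where z: "z \<in> g a"
    using g_nonempty[OF a(1)] by blast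
  have "z \<in> extension x"
    using a z gap_nonneg[of x] by (intro extension_memI[OF a(1) z]) (simp add: n_zero)
  then show ?thesis by blast
qed

text \<open>
  If the penalty of \<open>a\<close> alone does not exceed the height, then a point \<open>y\<close> that misses the sublevel set
  by less than \<open>c\<close> reaches it by moving less than \<open>c\<close> along the segment towards \<open>z \<in> g a\<close>. This is the
  step that needs a norm: small movements must be able to decrease the distance to \<open>z\<close>.
\<close>

lemma move_into_extension:
  assumes a: "a \<in> F" "z \<in> g a" and near: "3 * D x a \<le> 12 * gap x"
    and y: "n (y - z) + 3 * D x a < 12 * gap x + c" and "c > 0"
  shows "\<exists>w\<in>extension x. n (y - w) < c"
proof (cases "n (y - z) + 3 * D x a \<le> 12 * gap x")
  case True
  then have "y \<in> extension x" by (rule extension_memI[OF a])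
  then show ?thesis using \<open>c > 0\<close> by (intro bexI[of _ y]) (auto simp: n_zero)
next
  case False
  define \<rho> where "\<rho> = 12 * gap x - 3 * D x a"
  have \<rho>: "0 \<le> \<rho>" "\<rho> < n (y - z)" "n (y - z) < \<rho> + c"
    using near y False by (auto simp: \<rho>_def)
  define t where "t = \<rho> / n (y - z)"
  have t: "0 \<le> t" "t < 1" "t * n (y - z) = \<rho>"
    using \<rho> by (auto simp: t_def)
  \<comment> \<open>The point of the segment from \<open>z\<close> to \<open>y\<close> at distance \<open>\<rho>\<close> from \<open>z\<close>, where the height is attained.\<close>
  define w where "w = z + t *\<^sub>R (y - z)"
  have "n (w - z) = \<rho>"
    using t by (simp add: w_def n_scaleR)
  then have "w \<in> extension x"
    by (intro extension_memI[OF a]) (simp add: \<rho>_def)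
  moreover have "y - w = (1 - t) *\<^sub>R (y - z)"
    by (simp add: w_def algebra_simps)
  then have "n (y - w) = n (y - z) - \<rho>"
    using t by (simp only: n_scaleR) (simp add: left_diff_distrib)
  then have "n (y - w) < c"
    using \<rho> by simp
  ultimately show ?thesis by blast
qed

text \<open>
  Passing from \<open>x\<close> to \<open>x'\<close> changes a penalty by at most \<open>3 * c\<close> and the height by at most \<open>12 * c\<close>, so a point of the
  first set misses the second by less than \<open>16 * c\<close>, and it remains to move it there. This is not
  possible directly towards \<open>z \<in> g a\<close> if the penalty of \<open>a\<close> at \<open>x'\<close> exceeds the height. In that case \<open>a\<close> is
  replaced by a point \<open>b\<close> of \<open>F\<close> almost closest to \<open>x'\<close>: since \<open>D x' a\<close> is then at least twice
  \<open>D x' b\<close>, the gain in penalty outweighs the distance from \<open>z\<close> to \<open>g b\<close>. The bounds \<open>1/28\<close> and \<open>1/32\<close>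
  keep \<open>D a b\<close> below 1, where \<open>g\<close> is controlled.
\<close>

lemma extension_close:
  assumes x: "x \<in> S" "x' \<in> S" "gap x' < 1/28"
    and c: "D x x' < c" "c \<le> 1/32" and y: "y \<in> extension x"
  shows "\<exists>w\<in>extension x'. n (y - w) < 16 * c"
proof -
  have "c > 0" using c(1) D_nonneg[of x x'] by linarith
  then obtain a z where a: "a \<in> F" "z \<in> g a" and y1: "n (y - z) + 3 * D x a < 12 * gap x + c"
    using y unfolding extension_def by blast
  have aS: "a \<in> S" using a F by blast
  have "D x' a \<le> D x' x + D x a" "gap x \<le> D x x' + gap x'"
    using x aS by (auto intro: D_triangle gap_triangle)
  then have y2: "n (y - z) + 3 * D x' a < 12 * gap x' + 16 * c"
    using y1 c(1) D_commute[of x x'] by linarith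
  show ?thesis
  proof (cases "D x' a \<le> 4 * gap x'")
    case True
    then show ?thesis
      using \<open>c > 0\<close> by (intro move_into_extension[OF a _ y2]) auto
  next
    case False
    obtain b where b: "b \<in> F" "D x' b \<le> 2 * gap x'"
      using near_point[OF x(2)] .
    \<comment> \<open>The slack \<open>e\<close> is exactly the excess of \<open>2 * D x' a\<close> over \<open>4 * D x' b\<close> in the worst case \<open>D x' b = 2 * gap x'\<close>.\<close>
    define e where "e = 2 * D x' a - 8 * gap x'"
    have "D a b \<le> D a x' + D x' b"
      using aS b F(1) x(2) by (intro D_triangle) auto
    then have "D a b < D x' a + D x' b + e"
      using False D_commute[of a x'] by (simp add: e_def)
    moreover have "D x' a + D x' b + e \<le> 1"
      using y2 n_nonneg[of "y - z"] b(2) c(2) x(3) unfolding e_def by linarith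
    ultimately obtain w where w: "w \<in> g b" "n (z - w) < D x' a + D x' b + e"
      using g_close[OF a(1) b(1) _ _ a(2)] by blast
    have "n (y - w) \<le> n (y - z) + n (z - w)"
      using norm by (rule is_norm_triangle)
    then have "n (y - w) + 3 * D x' b < 12 * gap x' + 16 * c"
      using w(2) y2 b(2) unfolding e_def by linarith
    then show ?thesis
      using \<open>c > 0\<close> b(2) gap_nonneg[of x'] by (intro move_into_extension[OF b(1) w(1)]) auto
  qed
qed

text \<open>
  The function of \<open>y\<close> whose sublevel sets are taken is 1-Lipschitz, so these sets are closed.
\<close>

lemma complement_extension_ball:
  assumes "y \<notin> extension x"
  obtains r where "r > 0" "\<And>w. n (y - w) < r \<Longrightarrow> w \<notin> extension x"
proof -
  obtain e where e: "e > 0" "\<And>a z. a \<in> F \<Longrightarrow> z \<in> g a \<Longrightarrow> 12 * gap x + e \<le> n (y - z) + 3 * D x a"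
    using assms unfolding extension_def by (auto simp: not_less)
  show thesis
  proof (rule that[of "e / 2"])
    fix w assume w: "n (y - w) < e / 2"
    have "12 * gap x + e / 2 \<le> n (w - z) + 3 * D x a" if "a \<in> F" "z \<in> g a" for a z
      using e(2)[OF that] w is_norm_triangle[OF norm, of y z w] by linarith
    then have "\<not> (\<exists>a\<in>F. \<exists>z\<in>g a. n (w - z) + 3 * D x a < 12 * gap x + e / 2)"
      by (meson not_less)
    then show "w \<notin> extension x"
      unfolding extension_def using e(1) half_gt_zero by blast
  qed (use e in simp)
qed

text \<open>
  At a point \<open>x \<in> F\<close> the height is 0, so a point of the extension is a limit of points of
  sets \<open>g a\<close> with \<open>a\<close> tending to \<open>x\<close>, and these sets tend to \<open>g x\<close>.
\<close>

lemma extension_extends: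
  assumes x: "x \<in> F" and closed: "\<And>y. y \<notin> g x \<Longrightarrow> \<exists>r>0. \<forall>w. n (y - w) < r \<longrightarrow> w \<notin> g x"
  shows "extension x = g x"
proof (rule set_eqI, rule iffI)
  fix y assume "y \<in> g x"
  then show "y \<in> extension x"
    using x F gap_nonneg[of x] D_self[of x] by (intro extension_memI[OF x]) (auto simp: n_zero)
next
  fix y assume y: "y \<in> extension x"
  show "y \<in> g x"
  proof (rule ccontr)
    assume "y \<notin> g x"
    then obtain r where r: "r > 0" "\<And>w. n (y - w) < r \<Longrightarrow> w \<notin> g x"
      using closed by blast
    define e where "e = min 1 (r / 2)"
    have e: "e > 0" "e \<le> 1" "2 * e \<le> r"
      using r(1) by (auto simp: e_def)
    then obtain a z where a: "a \<in> F" "z \<in> g a" "n (y - z) + 3 * D x a < e"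
      using y unfolding extension_def by (auto simp: gap_eq_0[OF x])
    have "D a x < e" "n (y - z) < e"
      using a(3) D_nonneg[of x a] n_nonneg[of "y - z"] by (auto simp: D_commute[of a x])
    then obtain w where w: "w \<in> g x" "n (z - w) < e"
      using g_close[OF a(1) x _ e(2) a(2)] by blast
    then show False
      using r(2)[of w] is_norm_triangle[OF norm, of y w z] \<open>n (y - z) < e\<close> e(3) by force
  qed
qed

end

section \<open>Normability and the extension property of the hyperspace\<close>

text \<open>
  The inverse \<open>g\<close> of the embedding is extended from \<open>F\<close> to the points near \<open>F\<close> by the construction
  above, applied to the distance \<open>D\<close> that arises from the metric of \<open>M\<close> through a concave modulus
  of the norm with respect to \<open>d\<close>. The embedding then carries the values of the extension back to
  \<open>F\<close>, which gives the retraction.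
\<close>

theorem normable_imp_ANR_hyperspace:
  fixes d :: "'a::topological_real_vector metric" and n :: "'a \<Rightarrow> real"
  assumes d: "generates_linear_uniformity d" and n: "admissible_norm n"
  shows "metric_ANR TYPE('m) (hyperspace d)"
  unfolding metric_ANR_def
proof (intro allI impI, elim conjE)
  let ?Y = "hyperspace d"
  fix M :: "'m metric" and e
  assume isometry: "\<forall>x\<in>mspace ?Y. \<forall>y\<in>mspace ?Y. mdist M (e x) (e y) = mdist ?Y x y"
    and closed: "closedin (mtopology_of M) (e ` mspace ?Y)"
  define F where "F = e ` mspace ?Y"
  have inj: "inj_on e (mspace ?Y)"
  proof (rule inj_onI)
    fix A B assume "A \<in> mspace ?Y" "B \<in> mspace ?Y" "e A = e B"
    then show "A = B"
      using bspec[OF bspec[OF isometry], of A B] bspec[OF bspec[OF isometry], of B B]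
      by (simp add: mdist_self)
  qed
  define g where "g = inv_into (mspace ?Y) e"
  have g: "g (e A) = A" if "A \<in> mspace ?Y" for A
    unfolding g_def using inj that by (rule inv_into_f_f)
  have gF: "g a \<in> mspace ?Y" "e (g a) = a" if "a \<in> F" for a
    using that g by (auto simp: F_def)
  have g_iso: "mdist ?Y (g a) (g b) = mdist M a b" if "a \<in> F" "b \<in> F" for a b
    using gF[OF that(1)] gF[OF that(2)] isometry by metis

  \<comment> \<open>Both quantities range over pairs of points of the linear space. The truncation of \<open>q\<close> ensures that
    affine majorants exist.\<close>
  define q where "q = (\<lambda>(u, v). min 1 (n (u - v)))"
  define p where "p = (\<lambda>(u, v). mdist d u v)"
  have p: "0 \<le> p b" and q: "q b \<le> 1" for b
    by (auto simp: p_def q_def split: prod.split)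
  have norm: "is_norm n" using n by (simp add: admissible_norm_def)
  have uniform: "\<exists>\<delta>>0. \<forall>b. p b < \<delta> \<longrightarrow> q b \<le> c" if c: "c > 0" for c
  proof -
    obtain \<delta> where "\<delta> > 0" "\<forall>x y. mdist d x y < \<delta> \<longrightarrow> n (x - y) < c"
      using norm_small_if_mdist_small[OF d n c] by blast
    then show ?thesis
      by (intro exI[of _ \<delta>]) (auto simp: p_def q_def min.coboundedI2 less_imp_le)
  qed
  define D where "D = (\<lambda>x y. modulus q p (mdist M x y))"
  have D_ge: "mdist M x y \<le> D x y" for x y
    unfolding D_def by (rule modulus_ge[of p q, OF p q mdist_nonneg])
  have D_small: "\<exists>\<delta>>0. \<forall>x y. mdist M x y < \<delta> \<longrightarrow> D x y < c" if c: "c > 0" for c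
  proof -
    obtain \<delta> where "\<delta> > 0" "\<And>s. 0 \<le> s \<Longrightarrow> s < \<delta> \<Longrightarrow> modulus q p s < c"
      using modulus_small[of p q, OF p q uniform c] by blast
    then show ?thesis
      unfolding D_def by (intro exI[of _ \<delta>]) simp
  qed
  interpret hyperspace_extension n D "mspace M" F g
  proof
    show "is_norm n" by (rule norm)
    show nonneg: "0 \<le> D x y" for x y
      using D_ge[of x y] mdist_nonneg[of M x y] by linarith
    show "D x x = 0" if "x \<in> mspace M" for x
    proof (rule antisym)
      show "D x x \<le> 0"
      proof (rule field_le_epsilon)
        fix c :: real assume "c > 0"
        then obtain \<delta> where "\<delta> > 0" "\<forall>x y. mdist M x y < \<delta> \<longrightarrow> D x y < c"
          using D_small by blast
        then have "D x x < c"
          using mdist_self[OF that] by simp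
        then show "D x x \<le> 0 + c" by simp
      qed
    qed (rule nonneg)
    show "D x y = D y x" for x y
      by (simp add: D_def mdist_commute)
    show "D x z \<le> D x y + D y z" if "x \<in> mspace M" "y \<in> mspace M" "z \<in> mspace M" for x y z
    proof -
      have "D x z \<le> modulus q p (mdist M x y + mdist M y z)"
        unfolding D_def by (rule modulus_mono[of p q, OF p q mdist_nonneg mdist_triangle[OF that]])
      also have "\<dots> \<le> D x y + D y z"
        unfolding D_def by (rule modulus_subadditive[of p q, OF p q mdist_nonneg mdist_nonneg])
      finally show ?thesis .
    qed
    show "F \<subseteq> mspace M"
      using closedin_subset[OF closed] by (simp add: F_def)
    have "UNIV \<in> mspace ?Y" by (simp add: mspace_hyperspace[OF d])
    then show F_nonempty: "F \<noteq> {}" by (auto simp: F_def)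
    show "x \<in> F" if x: "x \<in> mspace M" "(INF a\<in>F. D x a) = 0" for x
    proof (rule ccontr)
      assume "x \<notin> F"
      then obtain r where r: "r > 0" "\<forall>a\<in>F. r \<le> mdist M x a"
        using closed x(1) unfolding closedin_mtopology_of_iff F_def by blast
      have "r \<le> (INF a\<in>F. D x a)"
        using F_nonempty by (rule cINF_greatest) (use r(2) D_ge in \<open>auto intro: order_trans\<close>)
      then show False using r(1) x(2) by simp
    qed
    show "g a \<noteq> {}" if "a \<in> F" for a
      using gF(1)[OF that] by (simp add: mspace_hyperspace[OF d])
    show "\<exists>w\<in>g b. n (u - w) < c"
      if a: "a \<in> F" "b \<in> F" "D a b < c" "c \<le> 1" "u \<in> g a" for a b c u
    proof -
      obtain \<alpha> \<beta> where ab: "0 \<le> \<alpha>" "1 \<le> \<beta>" "\<forall>b. q b \<le> \<alpha> + \<beta> * p b" "\<alpha> + \<beta> * mdist M a b < c"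
        using modulus_approx[of p q, OF p q a(3)[unfolded D_def]] by blast
      \<comment> \<open>The argument at which the affine majorant takes the value \<open>c\<close>. It is at most 1 because \<open>c \<le> 1 \<le> \<beta>\<close>.\<close>
      define s where "s = (c - \<alpha>) / \<beta>"
      have s: "mdist M a b < s" "\<alpha> + \<beta> * s = c"
        using ab(2,4) by (auto simp: s_def field_simps)
      have "0 \<le> s"
        using s(1) mdist_nonneg[of M a b] by linarith
      then have "s \<le> \<beta> * s"
        using mult_right_mono[OF ab(2)] by simp
      then have "s \<le> 1"
        using s(2) ab(1) a(4) by linarith
      then obtain w where w: "w \<in> g b" "mdist d u w < s"
        using mdist_hyperspace_less_imp[OF d, of "g a" "g b" s u] g_iso[OF a(1,2)] s(1) a(5) by auto
      have "q (u, w) \<le> \<alpha> + \<beta> * mdist d u w"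
        using spec[OF ab(3), of "(u, w)"] by (simp add: p_def)
      also have "\<dots> < c"
        using w(2) ab(2) s(2) mult_strict_left_mono[OF w(2), of \<beta>] by linarith
      finally show ?thesis
        using w(1) a(4) by (intro bexI[of _ w]) (auto simp: q_def)
    qed
  qed

  have closed_ext: "closed (extension x)" for x
  proof -
    have "\<exists>r>0. \<forall>w. n (y - w) < r \<longrightarrow> w \<in> - extension x" if "y \<in> - extension x" for y
      using complement_extension_ball[of y x] that by (metis ComplD ComplI)
    then have "open (- extension x)"
      using admissible_norm_open_iff[OF n] by blast
    then show ?thesis by (simp add: closed_def)
  qed
  have extends: "extension a = g a" if "a \<in> F" for a
  proof (rule extension_extends[OF that])
    fix y assume "y \<notin> g a"
    moreover have "open (- g a)"
      using gF(1)[OF that] by (auto simp: mspace_hyperspace[OF d])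
    ultimately show "\<exists>r>0. \<forall>w. n (y - w) < r \<longrightarrow> w \<notin> g a"
      using admissible_norm_open_iff[OF n, of "- g a"] by auto
  qed
  have ext_Y: "extension x \<in> mspace ?Y" if "x \<in> mspace M" for x
    using closed_ext extension_nonempty[OF that] by (simp add: mspace_hyperspace[OF d])

  define U where "U = {x\<in>mspace M. gap x < 1/28}"
  have FU: "F \<subseteq> U"
    using F(1) gap_eq_0 by (auto simp: U_def)
  have opU: "openin (mtopology_of M) U"
    unfolding openin_mtopology_of_iff
  proof (intro conjI ballI)
    fix x assume x: "x \<in> U"
    then obtain \<delta> where \<delta>: "\<delta> > 0" "\<forall>y z. mdist M y z < \<delta> \<longrightarrow> D y z < 1/28 - gap x"
      using D_small[of "1/28 - gap x"] by (auto simp: U_def)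
    have "y \<in> U" if y: "y \<in> mspace M" "mdist M x y < \<delta>" for y
    proof -
      have "D y x < 1/28 - gap x"
        using \<delta>(2) y(2) by (simp add: mdist_commute)
      then show ?thesis
        using gap_triangle[of y x] x y(1) by (auto simp: U_def)
    qed
    then show "\<exists>r>0. mball_of M x r \<subseteq> U"
      using \<delta>(1) by (intro exI[of _ \<delta>]) auto
  qed (auto simp: U_def)

  have "continuous_map (mtopology_of (submetric M U)) (mtopology_of (submetric M F)) (e \<circ> extension)"
    unfolding continuous_map_mtopology_of_iff
  proof (intro conjI ballI allI impI)
    show "(e \<circ> extension) ` mspace (submetric M U) \<subseteq> mspace (submetric M F)"
      using ext_Y F(1) by (auto simp: F_def)
    fix x and \<epsilon> :: real
    assume "x \<in> mspace (submetric M U)" and "\<epsilon> > 0"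
    then have x: "x \<in> mspace M" "gap x < 1/28" by (auto simp: U_def)
    obtain \<theta> where \<theta>: "\<theta> > 0" "\<forall>u v. n (u - v) < \<theta> \<longrightarrow> mdist d u v < \<epsilon> / 2"
      using mdist_small_if_norm_small[OF d n, of "\<epsilon> / 2"] \<open>\<epsilon> > 0\<close> by auto
    define c where "c = min (1/32) (\<theta> / 16)"
    have c: "c > 0" "c \<le> 1/32" "16 * c \<le> \<theta>"
      using \<theta>(1) by (auto simp: c_def)
    obtain \<delta> where \<delta>: "\<delta> > 0" "\<forall>y z. mdist M y z < \<delta> \<longrightarrow> D y z < c"
      using D_small[OF c(1)] by blast
    have "mdist M (e (extension x)) (e (extension y)) < \<epsilon>"
      if y: "y \<in> mspace M" "gap y < 1/28" "mdist M x y < \<delta>" for y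
    proof -
      have "D x y < c" "D y x < c"
        using \<delta>(2) y(3) by (auto simp: mdist_commute)
      note close = extension_close[OF x(1) y(1) y(2) this(1) c(2)]
        extension_close[OF y(1) x(1) x(2) this(2) c(2)]
      have mdist_small: "mdist d u w \<le> \<epsilon> / 2" if "n (u - w) < 16 * c" for u w
        using that \<theta>(2) c(3) by (intro less_imp_le) simp
      have "mdist ?Y (extension x) (extension y) \<le> \<epsilon> / 2"
      proof (rule mdist_hyperspace_le[OF d])
        show "\<exists>w\<in>extension y. mdist d u w \<le> \<epsilon> / 2" if "u \<in> extension x" for u
          using close(1)[OF that] mdist_small by blast
        show "\<exists>w\<in>extension x. mdist d u w \<le> \<epsilon> / 2" if "u \<in> extension y" for u
          using close(2)[OF that] mdist_small by blast
      qed (use \<open>\<epsilon> > 0\<close> in simp)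
      then show ?thesis
        using isometry ext_Y[OF x(1)] ext_Y[OF y(1)] \<open>\<epsilon> > 0\<close> by auto
    qed
    then show "\<exists>\<delta>>0. \<forall>y. y \<in> mspace (submetric M U) \<and> mdist (submetric M U) x y < \<delta> \<longrightarrow>
        mdist (submetric M F) ((e \<circ> extension) x) ((e \<circ> extension) y) < \<epsilon>"
      using \<delta>(1) by (intro exI[of _ \<delta>]) (auto simp: U_def)
  qed
  then have "continuous_map (subtopology (mtopology_of M) U)
      (subtopology (subtopology (mtopology_of M) U) F) (e \<circ> extension)"
    using FU by (simp add: mtopology_of_submetric subtopology_subtopology Int_absorb1)
  moreover have "(e \<circ> extension) a = a" if "a \<in> F" for a
    using extends[OF that] gF(2)[OF that] by simp
  ultimately have "F retract_of_space subtopology (mtopology_of M) U"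
    using FU F(1) unfolding retract_of_space_def by (auto intro!: exI[of _ "e \<circ> extension"])
  then show "\<exists>U. openin (mtopology_of M) U \<and> e ` mspace ?Y \<subseteq> U \<and>
      e ` mspace ?Y retract_of_space subtopology (mtopology_of M) U"
    using opU FU unfolding F_def by blast
qed

theorem corollary3:
  fixes d :: "'a::topological_real_vector metric"
  assumes "locally_convex TYPE('a)"
    and "metrizable_space (euclidean :: 'a topology)"
    and "generates_linear_uniformity d"
  shows "normable TYPE('a) \<longleftrightarrow> metric_ANR TYPE('m + ('a set \<Rightarrow> real)) (hyperspace d)"
proof
  assume "normable TYPE('a)"
  then show "metric_ANR TYPE('m + ('a set \<Rightarrow> real)) (hyperspace d)"
    unfolding normable_iff using normable_imp_ANR_hyperspace[OF assms(3)] by blast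
next
  assume ANR: "metric_ANR TYPE('m + ('a set \<Rightarrow> real)) (hyperspace d)"
  have "t1_space (euclidean :: 'a topology)"
    using assms(2) by (rule metrizable_imp_t1_space)
  then have "closed {x}" for x :: 'a
    by (simp add: t1_space_closedin_singleton)
  with ANR show "normable TYPE('a)"
    using ANR_hyperspace_imp_normable assms(1,3) by blast
qed

end
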